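(* Let $G$ be a group acting on a monoidal triangulated category $\mathbf{K}$ which is left or right rigid and such that $\operatorname{Spc}\mathbf{K}$ is a Noetherian topological space. The $G$-Balmer support $\Phi_G$, given by $\Phi_G(\mathbf{I})=\bigcup_{A\in\mathbf{I}}V^G(A)$, induces a bijection between $G$-ideals of $\mathbf{K}$ and specialization-closed subsets of $G\text{-}\operatorname{Spc}\mathbf{K}$.
   Context: A monoidal triangulated category is a triangulated category $\mathbf{K}$ with a monoidal structure $(\otimes,\mathbf{1})$ such that $\otimes$ is exact in each variable; no braiding is assumed. It is left (right) rigid if every object has a left (right) dual. An action of a group $G$ on $\mathbf{K}$ consists of autoequivalences of monoidal triangulated categories $T_g:\mathbf{K}\to\mathbf{K}$ (monoidal and triangulated), $g\in G$, and natural isomorphisms (of monoidal triangulated functors) $\gamma_{g,h}:T_gT_h\cong T_{gh}$ with $\gamma_{g,hk}\circ T_g\gamma_{h,k}=\gamma_{gh,k}\circ\gamma_{g,h}T_k$ for all $g,h,k\in G$. All subcategories are full and closed under isomorphism. A thick ideal is a triangulated subcategory closed under direct summands and under $\otimes$ on both sides with arbitrary objects. A prime ideal is a proper thick ideal $\mathbf{P}$ such that $\mathbf{I}\otimes\mathbf{J}\subseteq\mathbf{P}$ implies $\mathbf{I}\subseteq\mathbf{P}$ or $\mathbf{J}\subseteq\mathbf{P}$ for thick ideals $\mathbf{I},\mathbf{J}$ (equivalently, $A\otimes\mathbf{K}\otimes B\subseteq\mathbf{P}$ implies $A\in\mathbf{P}$ or $B\in\mathbf{P}$). $\operatorname{Spc}\mathbf{K}$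 is the set of prime ideals, with closed sets $V(\mathbf{S})=\{\mathbf{P}:\mathbf{S}\cap\mathbf{P}=\varnothing\}$ for collections $\mathbf{S}$ of objects. A $G$-ideal of $\mathbf{K}$ is a thick ideal $\mathbf{I}$ with $T_g\mathbf{I}\subseteq\mathbf{I}$ for all $g\in G$, where $T_g\mathbf{I}=\{T_gA:A\in\mathbf{I}\}$. A $G$-prime is a proper $G$-ideal $\mathbf{Q}$ such that for all $G$-ideals $\mathbf{I},\mathbf{J}$, $\mathbf{I}\otimes\mathbf{J}\subseteq\mathbf{Q}$ implies $\mathbf{I}\subseteq\mathbf{Q}$ or $\mathbf{J}\subseteq\mathbf{Q}$. $G\text{-}\operatorname{Spc}\mathbf{K}$ is the set of $G$-primes with closed sets $V^G(\mathbf{S})=\{\mathbf{Q}:\mathbf{S}\cap\mathbf{Q}=\varnothing\}$ for collections $\mathbf{S}$ of objects; $V^G(A)=V^G(\{A\})$. A subset of a space is specialization-closed if it is an arbitrary union of closed sets. *)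

theory Defs
  imports "HOL-Algebra.Group" "HOL-Analysis.Abstract_Topology"
begin

section \<open>Categories and endofunctors\<close>

record ('o, 'm) cat =
  Ob :: "'o set"
  Ar :: "'m set"
  src :: "'m \<Rightarrow> 'o"
  trg :: "'m \<Rightarrow> 'o"
  idn :: "'o \<Rightarrow> 'm" ("\<one>\<^sub>m\<index>")
  cmp :: "'m \<Rightarrow> 'm \<Rightarrow> 'm" (infixl "\<cdot>\<index>" 70)

text \<open>Composition is written in the usual order: \<open>g \<cdot> f\<close> is \<open>f\<close> followed by \<open>g\<close>.\<close>

definition Hom :: "('o, 'm, 'z) cat_scheme \<Rightarrow> 'o \<Rightarrow> 'o \<Rightarrow> 'm set" where
  "Hom C A B = {f \<in> Ar C. src C f = A \<and> trg C f = B}"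

locale category =
  fixes C :: "('o, 'm, 'z) cat_scheme" (structure)
  assumes src_Ob: "f \<in> Ar C \<Longrightarrow> src C f \<in> Ob C"
    and trg_Ob: "f \<in> Ar C \<Longrightarrow> trg C f \<in> Ob C"
    and idn_Hom: "A \<in> Ob C \<Longrightarrow> \<one>\<^sub>m A \<in> Hom C A A"
    and cmp_Hom: "f \<in> Hom C A B \<Longrightarrow> g \<in> Hom C B D \<Longrightarrow> g \<cdot> f \<in> Hom C A D"
    and cmp_idn: "f \<in> Hom C A B \<Longrightarrow> f \<cdot> \<one>\<^sub>m A = f"
    and idn_cmp: "f \<in> Hom C A B \<Longrightarrow> \<one>\<^sub>m B \<cdot> f = f"
    and cmp_assoc: "f \<in> Hom C A B \<Longrightarrow> g \<in> Hom C B D \<Longrightarrow> h \<in> Hom C D E \<Longrightarrow>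
      h \<cdot> (g \<cdot> f) = (h \<cdot> g) \<cdot> f"

definition is_iso :: "('o, 'm, 'z) cat_scheme \<Rightarrow> 'm \<Rightarrow> bool" where
  "is_iso C f \<longleftrightarrow> f \<in> Ar C \<and>
     (\<exists>g \<in> Hom C (trg C f) (src C f).
        cmp C g f = idn C (src C f) \<and> cmp C f g = idn C (trg C f))"

definition inv_ar :: "('o, 'm, 'z) cat_scheme \<Rightarrow> 'm \<Rightarrow> 'm" where
  "inv_ar C f = (THE g. g \<in> Hom C (trg C f) (src C f) \<and>
     cmp C g f = idn C (src C f) \<and> cmp C f g = idn C (trg C f))"

definition isomorphic :: "('o, 'm, 'z) cat_scheme \<Rightarrow> 'o \<Rightarrow> 'o \<Rightarrow> bool" where
  "isomorphic C A B \<longleftrightarrow> (\<exists>f \<in> Hom C A B. is_iso C f)"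

record ('o, 'm) endofun =
  fob :: "'o \<Rightarrow> 'o"
  far :: "'m \<Rightarrow> 'm"

definition id_fun :: "('o, 'm) endofun" where
  "id_fun = \<lparr>fob = (\<lambda>A. A), far = (\<lambda>f. f)\<rparr>"

definition comp_fun ::
    "('o, 'm, 'y) endofun_scheme \<Rightarrow> ('o, 'm, 'x) endofun_scheme \<Rightarrow> ('o, 'm) endofun" where
  "comp_fun F H = \<lparr>fob = (\<lambda>A. fob F (fob H A)), far = (\<lambda>f. far F (far H f))\<rparr>"

locale endofunctor = category C for C :: "('o, 'm, 'z) cat_scheme" (structure) +
  fixes F :: "('o, 'm, 'y) endofun_scheme"
  assumes fob_Ob: "A \<in> Ob C \<Longrightarrow> fob F A \<in> Ob C"
    and far_Hom: "f \<in> Hom C A B \<Longrightarrow> far F f \<in> Hom C (fob F A) (fob F B)"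
    and far_idn: "A \<in> Ob C \<Longrightarrow> far F (\<one>\<^sub>m A) = \<one>\<^sub>m (fob F A)"
    and far_cmp: "f \<in> Hom C A B \<Longrightarrow> g \<in> Hom C B D \<Longrightarrow> far F (g \<cdot> f) = far F g \<cdot> far F f"

definition nat_iso :: "('o, 'm, 'z) cat_scheme \<Rightarrow> ('o, 'm, 'y) endofun_scheme \<Rightarrow>
    ('o, 'm, 'x) endofun_scheme \<Rightarrow> ('o \<Rightarrow> 'm) \<Rightarrow> bool" where
  "nat_iso C F H \<eta> \<longleftrightarrow>
     (\<forall>A \<in> Ob C. \<eta> A \<in> Hom C (fob F A) (fob H A) \<and> is_iso C (\<eta> A)) \<and>
     (\<forall>A B. \<forall>f \<in> Hom C A B. cmp C (\<eta> B) (far F f) = cmp C (far H f) (\<eta> A))"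

definition autoequivalence ::
    "('o, 'm, 'z) cat_scheme \<Rightarrow> ('o, 'm, 'y) endofun_scheme \<Rightarrow> bool" where
  "autoequivalence C F \<longleftrightarrow> endofunctor C F \<and>
     (\<exists>H :: ('o, 'm) endofun. endofunctor C H \<and>
        (\<exists>\<eta>. nat_iso C (comp_fun F H) id_fun \<eta>) \<and> (\<exists>\<eta>. nat_iso C (comp_fun H F) id_fun \<eta>))"


section \<open>Additive categories\<close>

record ('o, 'm) add_cat = "('o, 'm) cat" +
  padd :: "'m \<Rightarrow> 'm \<Rightarrow> 'm" (infixl "+\<^sub>m\<index>" 65)
  pzero :: "'o \<Rightarrow> 'o \<Rightarrow> 'm" ("\<zero>\<^sub>m\<index>")

definition Hom_group :: "('o, 'm, 'z) add_cat_scheme \<Rightarrow> 'o \<Rightarrow> 'o \<Rightarrow> 'm monoid" where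
  "Hom_group C A B =
     \<lparr>carrier = Hom C A B, monoid.mult = padd C, monoid.one = pzero C A B\<rparr>"

definition neg :: "('o, 'm, 'z) add_cat_scheme \<Rightarrow> 'm \<Rightarrow> 'm" where
  "neg C f = inv\<^bsub>Hom_group C (src C f) (trg C f)\<^esub> f"

definition zero_object :: "('o, 'm, 'z) cat_scheme \<Rightarrow> 'o \<Rightarrow> bool" where
  "zero_object C Z \<longleftrightarrow> Z \<in> Ob C \<and>
     (\<forall>A \<in> Ob C. (\<exists>!f. f \<in> Hom C A Z) \<and> (\<exists>!f. f \<in> Hom C Z A))"

text \<open>\<open>direct_sum C A B D\<close>: the object \<open>D\<close> is a biproduct of \<open>A\<close> and \<open>B\<close>.\<close>

definition direct_sum :: "('o, 'm, 'z) add_cat_scheme \<Rightarrow> 'o \<Rightarrow> 'o \<Rightarrow> 'o \<Rightarrow> bool" where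
  "direct_sum C A B D \<longleftrightarrow> A \<in> Ob C \<and> B \<in> Ob C \<and> D \<in> Ob C \<and>
     (\<exists>i \<in> Hom C A D. \<exists>j \<in> Hom C B D. \<exists>p \<in> Hom C D A. \<exists>q \<in> Hom C D B.
        cmp C p i = idn C A \<and> cmp C q j = idn C B \<and>
        cmp C p j = pzero C B A \<and> cmp C q i = pzero C A B \<and>
        padd C (cmp C i p) (cmp C j q) = idn C D)"

locale additive_category = category C for C :: "('o, 'm, 'z) add_cat_scheme" (structure) +
  assumes Hom_comm_group: "A \<in> Ob C \<Longrightarrow> B \<in> Ob C \<Longrightarrow> comm_group (Hom_group C A B)"
    and cmp_padd: "f \<in> Hom C A B \<Longrightarrow> f' \<in> Hom C A B \<Longrightarrow> g \<in> Hom C B D \<Longrightarrow>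
      g \<cdot> (f +\<^sub>m f') = g \<cdot> f +\<^sub>m g \<cdot> f'"
    and padd_cmp: "f \<in> Hom C A B \<Longrightarrow> g \<in> Hom C B D \<Longrightarrow> g' \<in> Hom C B D \<Longrightarrow>
      (g +\<^sub>m g') \<cdot> f = g \<cdot> f +\<^sub>m g' \<cdot> f"
    and ex_zero_object: "\<exists>Z. zero_object C Z"
    and ex_direct_sum: "A \<in> Ob C \<Longrightarrow> B \<in> Ob C \<Longrightarrow> \<exists>D. direct_sum C A B D"

definition additive_functor ::
    "('o, 'm, 'z) add_cat_scheme \<Rightarrow> ('o, 'm, 'y) endofun_scheme \<Rightarrow> bool" where
  "additive_functor C F \<longleftrightarrow> endofunctor C F \<and>
     (\<forall>A B. \<forall>f \<in> Hom C A B. \<forall>g \<in> Hom C A B. far F (padd C f g) = padd C (far F f) (far F g))"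


section \<open>Triangulated categories\<close>

text \<open>\<open>(f, g, h) \<in> dist C\<close> means that \<open>X \<rightarrow> Y \<rightarrow> Z \<rightarrow> \<Sigma>X\<close>, with maps \<open>f\<close>, \<open>g\<close>, \<open>h\<close>, is a
  distinguished triangle; the objects are determined by the arrows.\<close>

record ('o, 'm) tri_cat = "('o, 'm) add_cat" +
  shift :: "('o, 'm) endofun"
  dist :: "('m \<times> 'm \<times> 'm) set"

abbreviation shift_ob :: "('o, 'm, 'z) tri_cat_scheme \<Rightarrow> 'o \<Rightarrow> 'o" ("\<Sigma>\<^sub>o\<index>") where
  "shift_ob C \<equiv> fob (shift C)"

abbreviation shift_ar :: "('o, 'm, 'z) tri_cat_scheme \<Rightarrow> 'm \<Rightarrow> 'm" ("\<Sigma>\<^sub>m\<index>") where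
  "shift_ar C \<equiv> far (shift C)"

definition triangle :: "('o, 'm, 'z) tri_cat_scheme \<Rightarrow> 'o \<Rightarrow> 'o \<Rightarrow> 'o \<Rightarrow> 'm \<Rightarrow> 'm \<Rightarrow> 'm \<Rightarrow> bool" where
  "triangle C X Y Z f g h \<longleftrightarrow> X \<in> Ob C \<and> Y \<in> Ob C \<and> Z \<in> Ob C \<and>
     f \<in> Hom C X Y \<and> g \<in> Hom C Y Z \<and> h \<in> Hom C Z (shift_ob C X)"

definition dist_triangle ::
    "('o, 'm, 'z) tri_cat_scheme \<Rightarrow> 'o \<Rightarrow> 'o \<Rightarrow> 'o \<Rightarrow> 'm \<Rightarrow> 'm \<Rightarrow> 'm \<Rightarrow> bool" where
  "dist_triangle C X Y Z f g h \<longleftrightarrow> triangle C X Y Z f g h \<and> (f, g, h) \<in> dist C"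

definition triangle_morphism :: "('o, 'm, 'z) tri_cat_scheme \<Rightarrow>
    'm \<times> 'm \<times> 'm \<Rightarrow> 'm \<times> 'm \<times> 'm \<Rightarrow> 'm \<Rightarrow> 'm \<Rightarrow> 'm \<Rightarrow> bool" where
  "triangle_morphism C = (\<lambda>(f, g, h) (f', g', h') a b c.
     a \<in> Hom C (src C f) (src C f') \<and> b \<in> Hom C (src C g) (src C g') \<and>
     c \<in> Hom C (src C h) (src C h') \<and>
     cmp C b f = cmp C f' a \<and> cmp C c g = cmp C g' b \<and> cmp C (shift_ar C a) h = cmp C h' c)"

locale triangulated_category = additive_category C
  for C :: "('o, 'm, 'z) tri_cat_scheme" (structure) +
  assumes shift_autoequivalence: "autoequivalence C (shift C)"
    and shift_additive: "additive_functor C (shift C)"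
    and dist_iso_closed: "dist_triangle C X Y Z f g h \<Longrightarrow> triangle C X' Y' Z' f' g' h' \<Longrightarrow>
      triangle_morphism C (f, g, h) (f', g', h') a b c \<Longrightarrow>
      is_iso C a \<Longrightarrow> is_iso C b \<Longrightarrow> is_iso C c \<Longrightarrow> dist_triangle C X' Y' Z' f' g' h'"
    and dist_idn: "X \<in> Ob C \<Longrightarrow> zero_object C Z \<Longrightarrow>
      dist_triangle C X X Z (\<one>\<^sub>m X) (\<zero>\<^sub>m X Z) (\<zero>\<^sub>m Z (\<Sigma>\<^sub>o X))"
    and dist_complete: "f \<in> Hom C X Y \<Longrightarrow> \<exists>Z g h. dist_triangle C X Y Z f g h"
    and dist_rotate: "triangle C X Y Z f g h \<Longrightarrow>
      dist_triangle C X Y Z f g h \<longleftrightarrow> dist_triangle C Y Z (\<Sigma>\<^sub>o X) g h (neg C (\<Sigma>\<^sub>m f))"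
    and dist_fill: "dist_triangle C X Y Z f g h \<Longrightarrow> dist_triangle C X' Y' Z' f' g' h' \<Longrightarrow>
      a \<in> Hom C X X' \<Longrightarrow> b \<in> Hom C Y Y' \<Longrightarrow> b \<cdot> f = f' \<cdot> a \<Longrightarrow>
      \<exists>c. triangle_morphism C (f, g, h) (f', g', h') a b c"
    and octahedral: "dist_triangle C X Y U f a a' \<Longrightarrow> dist_triangle C Y Z V g b b' \<Longrightarrow>
      dist_triangle C X Z W (g \<cdot> f) c c' \<Longrightarrow>
      \<exists>p q. dist_triangle C U W V p q (\<Sigma>\<^sub>m a \<cdot> b') \<and>
        triangle_morphism C (f, a, a') (g \<cdot> f, c, c') (\<one>\<^sub>m X) g p \<and>
        triangle_morphism C (g \<cdot> f, c, c') (g, b, b') f (\<one>\<^sub>m Z) q"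

definition triangulated_functor :: "('o, 'm, 'z) tri_cat_scheme \<Rightarrow>
    ('o, 'm, 'y) endofun_scheme \<Rightarrow> ('o \<Rightarrow> 'm) \<Rightarrow> bool" where
  "triangulated_functor C F \<phi> \<longleftrightarrow> additive_functor C F \<and>
     nat_iso C (comp_fun F (shift C)) (comp_fun (shift C) F) \<phi> \<and>
     (\<forall>X Y Z f g h. dist_triangle C X Y Z f g h \<longrightarrow>
        dist_triangle C (fob F X) (fob F Y) (fob F Z) (far F f) (far F g) (cmp C (\<phi> X) (far F h)))"

definition exact_functor :: "('o, 'm, 'z) tri_cat_scheme \<Rightarrow> ('o, 'm, 'y) endofun_scheme \<Rightarrow> bool" where
  "exact_functor C F \<longleftrightarrow> (\<exists>\<phi>. triangulated_functor C F \<phi>)"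

text \<open>Full subcategories closed under isomorphism are represented by their sets of objects.\<close>

definition iso_closed :: "('o, 'm, 'z) cat_scheme \<Rightarrow> 'o set \<Rightarrow> bool" where
  "iso_closed C I \<longleftrightarrow> I \<subseteq> Ob C \<and> (\<forall>A \<in> I. \<forall>B \<in> Ob C. isomorphic C A B \<longrightarrow> B \<in> I)"

definition triangulated_subcategory :: "('o, 'm, 'z) tri_cat_scheme \<Rightarrow> 'o set \<Rightarrow> bool" where
  "triangulated_subcategory C I \<longleftrightarrow> iso_closed C I \<and>
     (\<exists>Z \<in> I. zero_object C Z) \<and>
     (\<forall>X \<in> Ob C. X \<in> I \<longleftrightarrow> shift_ob C X \<in> I) \<and>
     (\<forall>X Y Z f g h. dist_triangle C X Y Z f g h \<longrightarrow>
        (X \<in> I \<and> Y \<in> I \<longrightarrow> Z \<in> I) \<and> (Y \<in> I \<and> Z \<in> I \<longrightarrow> X \<in> I) \<and> (X \<in> I \<and> Z \<in> I \<longrightarrow> Y \<in> I))"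

definition thick_subcategory :: "('o, 'm, 'z) tri_cat_scheme \<Rightarrow> 'o set \<Rightarrow> bool" where
  "thick_subcategory C I \<longleftrightarrow> triangulated_subcategory C I \<and>
     (\<forall>A B D. direct_sum C A B D \<and> D \<in> I \<longrightarrow> A \<in> I \<and> B \<in> I)"


text \<open>Needed below to see that the spectra are topological spaces: a thick subcategory contains
  a direct sum iff it contains both summands.\<close>

context additive_category
begin

lemma Hom_Ob: "f \<in> Hom C A B \<Longrightarrow> A \<in> Ob C \<and> B \<in> Ob C"
  using src_Ob trg_Ob by (auto simp: Hom_def)

lemma pzero_Hom: "A \<in> Ob C \<Longrightarrow> B \<in> Ob C \<Longrightarrow> \<zero>\<^sub>m A B \<in> Hom C A B"
  using group.is_monoid[OF comm_group.axioms(2)[OF Hom_comm_group], THEN monoid.one_closed]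
  by (simp add: Hom_group_def)

lemma
  assumes f: "f \<in> Hom C A B"
  shows padd_pzero: "f +\<^sub>m \<zero>\<^sub>m A B = f"
    and pzero_padd: "\<zero>\<^sub>m A B +\<^sub>m f = f"
    and neg_Hom: "neg C f \<in> Hom C A B"
    and padd_neg: "f +\<^sub>m neg C f = \<zero>\<^sub>m A B"
    and padd_idem: "f +\<^sub>m f = f \<Longrightarrow> f = \<zero>\<^sub>m A B"
    and padd_Hom: "g \<in> Hom C A B \<Longrightarrow> f +\<^sub>m g \<in> Hom C A B"
    and padd_neg_cancel: "g \<in> Hom C A B \<Longrightarrow> f +\<^sub>m neg C g = \<zero>\<^sub>m A B \<Longrightarrow> f = g"
proof -
  interpret H: comm_group "Hom_group C A B"
    using Hom_comm_group Hom_Ob[OF f] by blast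
  have [simp]: "carrier (Hom_group C A B) = Hom C A B"
    "x \<otimes>\<^bsub>Hom_group C A B\<^esub> y = x +\<^sub>m y" "\<one>\<^bsub>Hom_group C A B\<^esub> = \<zero>\<^sub>m A B" for x y
    by (simp_all add: Hom_group_def)
  have neg: "neg C x = inv\<^bsub>Hom_group C A B\<^esub> x" if "x \<in> Hom C A B" for x
    using that by (auto simp: neg_def Hom_def)
  show "f +\<^sub>m \<zero>\<^sub>m A B = f" "\<zero>\<^sub>m A B +\<^sub>m f = f" "neg C f \<in> Hom C A B" "f +\<^sub>m neg C f = \<zero>\<^sub>m A B"
    using H.r_one[of f] H.l_one[of f] H.inv_closed[of f] H.r_inv[of f] f by (simp_all add: neg)
  show "f = \<zero>\<^sub>m A B" if "f +\<^sub>m f = f"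
    using H.l_cancel_one[of f f] f that by simp
  show "f +\<^sub>m g \<in> Hom C A B" if "g \<in> Hom C A B"
    using H.m_closed[of f g] f that by simp
  show "f = g" if "g \<in> Hom C A B" "f +\<^sub>m neg C g = \<zero>\<^sub>m A B"
    using H.inv_equality[of f "neg C g"] H.inv_inv[of g] H.inv_closed[of g] f that
    by (simp add: neg)
qed

lemma cmp_pzero:
  assumes g: "g \<in> Hom C B D" and A: "A \<in> Ob C"
  shows "g \<cdot> \<zero>\<^sub>m A B = \<zero>\<^sub>m A D"
proof -
  have z: "\<zero>\<^sub>m A B \<in> Hom C A B"
    using pzero_Hom A Hom_Ob[OF g] by blast
  show ?thesis
    using padd_idem[OF cmp_Hom[OF z g]] cmp_padd[OF z z g] padd_pzero[OF z] by simp
qed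

lemma pzero_cmp:
  assumes f: "f \<in> Hom C A B" and D: "D \<in> Ob C"
  shows "\<zero>\<^sub>m B D \<cdot> f = \<zero>\<^sub>m A D"
proof -
  have z: "\<zero>\<^sub>m B D \<in> Hom C B D"
    using pzero_Hom D Hom_Ob[OF f] by blast
  show ?thesis
    using padd_idem[OF cmp_Hom[OF f z]] padd_cmp[OF f z z] padd_pzero[OF z] by simp
qed

lemma neg_cmp:
  assumes f: "f \<in> Hom C A B" and g: "g \<in> Hom C B D"
  shows "g \<cdot> f +\<^sub>m neg C g \<cdot> f = \<zero>\<^sub>m A D"
  using padd_cmp[OF f g neg_Hom[OF g]] padd_neg[OF g] pzero_cmp[OF f, of D] Hom_Ob[OF g] by simp

lemma zero_object_iff: "zero_object C Z \<longleftrightarrow> Z \<in> Ob C \<and> \<one>\<^sub>m Z = \<zero>\<^sub>m Z Z"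
proof
  show "Z \<in> Ob C \<and> \<one>\<^sub>m Z = \<zero>\<^sub>m Z Z" if "zero_object C Z"
    using that idn_Hom pzero_Hom unfolding zero_object_def by metis
  assume Z: "Z \<in> Ob C \<and> \<one>\<^sub>m Z = \<zero>\<^sub>m Z Z"
  have "f = \<zero>\<^sub>m A Z" if "f \<in> Hom C A Z" for f A
    using idn_cmp[OF that] pzero_cmp[OF that] Z by metis
  moreover have "f = \<zero>\<^sub>m Z A" if "f \<in> Hom C Z A" for f A
    using cmp_idn[OF that] cmp_pzero[OF that] Z by metis
  ultimately show "zero_object C Z"
    unfolding zero_object_def using Z pzero_Hom by metis
qed

end

context triangulated_category
begin

lemma endofunctor_shift: "endofunctor C (shift C)"
  using shift_additive by (simp add: additive_functor_def)

lemma shift_zero_object: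
  assumes "zero_object C Z"
  shows "zero_object C (\<Sigma>\<^sub>o Z)"
proof -
  interpret S: endofunctor C "shift C"
    by (rule endofunctor_shift)
  have Z: "Z \<in> Ob C" "\<one>\<^sub>m Z = \<zero>\<^sub>m Z Z"
    using assms by (auto simp: zero_object_iff)
  have 1: "\<one>\<^sub>m Z \<in> Hom C Z Z"
    by (rule idn_Hom[OF Z(1)])
  have "\<one>\<^sub>m Z +\<^sub>m \<one>\<^sub>m Z = \<one>\<^sub>m Z"
    using padd_pzero[OF 1] Z by simp
  then have "\<one>\<^sub>m (\<Sigma>\<^sub>o Z) +\<^sub>m \<one>\<^sub>m (\<Sigma>\<^sub>o Z) = \<one>\<^sub>m (\<Sigma>\<^sub>o Z)"
    using shift_additive 1 S.far_idn[OF Z(1)] unfolding additive_functor_def by metis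
  then show ?thesis
    using padd_idem idn_Hom S.fob_Ob[OF Z(1)] by (simp add: zero_object_iff)
qed

lemma dist_cmp_zero:
  assumes T: "dist_triangle C X Y Z f g h"
  shows "g \<cdot> f = \<zero>\<^sub>m X Z"
proof -
  have f: "f \<in> Hom C X Y" "X \<in> Ob C"
    using T by (auto simp: dist_triangle_def triangle_def)
  obtain O' where O': "zero_object C O'"
    using ex_zero_object by blast
  have I: "dist_triangle C X X O' (\<one>\<^sub>m X) (\<zero>\<^sub>m X O') (\<zero>\<^sub>m O' (\<Sigma>\<^sub>o X))"
    by (rule dist_idn[OF f(2) O'])
  obtain c where c: "triangle_morphism C (\<one>\<^sub>m X, \<zero>\<^sub>m X O', \<zero>\<^sub>m O' (\<Sigma>\<^sub>o X)) (f, g, h) (\<one>\<^sub>m X) f c"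
    using dist_fill[OF I T idn_Hom[OF f(2)] f(1)] by blast
  have "src C h = Z" "src C (\<zero>\<^sub>m O' (\<Sigma>\<^sub>o X)) = O'"
    using T I by (auto simp: dist_triangle_def triangle_def Hom_def)
  then have "c \<in> Hom C O' Z" "c \<cdot> \<zero>\<^sub>m X O' = g \<cdot> f"
    using c by (auto simp: triangle_morphism_def)
  then show ?thesis
    using cmp_pzero f by metis
qed

lemma dist_weak_cokernel:
  assumes T: "dist_triangle C X Y Z f g h" and u: "u \<in> Hom C Y W" and uf: "u \<cdot> f = \<zero>\<^sub>m X W"
  shows "\<exists>t \<in> Hom C Z W. t \<cdot> g = u"
proof -
  interpret S: endofunctor C "shift C"
    by (rule endofunctor_shift)
  have X: "X \<in> Ob C" and W: "W \<in> Ob C"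
    using T u Hom_Ob by (auto simp: dist_triangle_def triangle_def)
  obtain O' where O': "zero_object C O'"
    using ex_zero_object by blast
  have O: "O' \<in> Ob C"
    using O' by (simp add: zero_object_def)
  let ?z = "\<zero>\<^sub>m O' W" and ?w = "\<zero>\<^sub>m W (\<Sigma>\<^sub>o O')"
  have tri: "triangle C O' W W ?z (\<one>\<^sub>m W) ?w"
    unfolding triangle_def using O W S.fob_Ob pzero_Hom idn_Hom by blast
  have "neg C (\<Sigma>\<^sub>m ?z) \<in> Hom C (\<Sigma>\<^sub>o O') (\<Sigma>\<^sub>o W)" "\<zero>\<^sub>m (\<Sigma>\<^sub>o O') (\<Sigma>\<^sub>o W) \<in> Hom C (\<Sigma>\<^sub>o O') (\<Sigma>\<^sub>o W)"
    using neg_Hom S.far_Hom pzero_Hom S.fob_Ob O W by blast+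
  then have "neg C (\<Sigma>\<^sub>m ?z) = \<zero>\<^sub>m (\<Sigma>\<^sub>o O') (\<Sigma>\<^sub>o W)"
    using shift_zero_object[OF O'] S.fob_Ob[OF W] unfolding zero_object_def by blast
  then have D: "dist_triangle C O' W W ?z (\<one>\<^sub>m W) ?w"
    using dist_rotate[OF tri] dist_idn[OF W shift_zero_object[OF O']] by simp
  have a: "\<zero>\<^sub>m X O' \<in> Hom C X O'"
    by (rule pzero_Hom[OF X O])
  have "u \<cdot> f = ?z \<cdot> \<zero>\<^sub>m X O'"
    using uf pzero_cmp[OF a W] by simp
  then obtain c where c: "triangle_morphism C (f, g, h) (?z, \<one>\<^sub>m W, ?w) (\<zero>\<^sub>m X O') u c"
    using dist_fill[OF T D a u] by blast
  have "src C h = Z" "src C ?w = W"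
    using T D by (auto simp: dist_triangle_def triangle_def Hom_def)
  then have "c \<in> Hom C Z W" "c \<cdot> g = \<one>\<^sub>m W \<cdot> u"
    using c by (auto simp: triangle_morphism_def)
  then show ?thesis
    using idn_cmp[OF u] by metis
qed

lemma dist_rotated:
  assumes T: "dist_triangle C X Y Z f g h"
  shows "dist_triangle C Y Z (\<Sigma>\<^sub>o X) g h (neg C (\<Sigma>\<^sub>m f))"
  using T dist_rotate[of X Y Z f g h] unfolding dist_triangle_def by blast

lemma direct_sum_mem:
  assumes I: "triangulated_subcategory C I" and D: "direct_sum C A B D" and "A \<in> I" "B \<in> I"
  shows "D \<in> I"
proof -
  interpret S: endofunctor C "shift C"
    by (rule endofunctor_shift)
  obtain i j p q where i: "i \<in> Hom C A D" and j: "j \<in> Hom C B D" and p: "p \<in> Hom C D A"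
    and q: "q \<in> Hom C D B" and pi: "p \<cdot> i = \<one>\<^sub>m A" and qj: "q \<cdot> j = \<one>\<^sub>m B"
    and qi: "q \<cdot> i = \<zero>\<^sub>m A B" and sum: "i \<cdot> p +\<^sub>m j \<cdot> q = \<one>\<^sub>m D"
    using D unfolding direct_sum_def by blast
  have Ob: "A \<in> Ob C" "B \<in> Ob C" "D \<in> Ob C"
    using D by (auto simp: direct_sum_def)
  obtain Z c c' where T: "dist_triangle C A D Z i c c'"
    using dist_complete[OF i] by blast
  then have c: "c \<in> Hom C D Z" and c': "c' \<in> Hom C Z (\<Sigma>\<^sub>o A)" and Z: "Z \<in> Ob C"
    by (auto simp: dist_triangle_def triangle_def)
  have SA: "\<Sigma>\<^sub>o A \<in> Ob C" and SD: "\<Sigma>\<^sub>o D \<in> Ob C"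
    using S.fob_Ob Ob by auto
  have Si: "\<Sigma>\<^sub>m i \<in> Hom C (\<Sigma>\<^sub>o A) (\<Sigma>\<^sub>o D)" and Sp: "\<Sigma>\<^sub>m p \<in> Hom C (\<Sigma>\<^sub>o D) (\<Sigma>\<^sub>o A)"
    using S.far_Hom i p by auto
  have "neg C (\<Sigma>\<^sub>m i) \<cdot> c' = \<zero>\<^sub>m Z (\<Sigma>\<^sub>o D)"
    by (rule dist_cmp_zero[OF dist_rotated[OF dist_rotated[OF T]]])
  then have "\<Sigma>\<^sub>m i \<cdot> c' = \<zero>\<^sub>m Z (\<Sigma>\<^sub>o D)"
    using neg_cmp[OF c' Si] padd_pzero[OF cmp_Hom[OF c' Si]] by simp
  then have "\<Sigma>\<^sub>m p \<cdot> (\<Sigma>\<^sub>m i \<cdot> c') = \<zero>\<^sub>m Z (\<Sigma>\<^sub>o A)"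
    using cmp_pzero[OF Sp Z] by simp
  moreover have "\<Sigma>\<^sub>m p \<cdot> \<Sigma>\<^sub>m i = \<one>\<^sub>m (\<Sigma>\<^sub>o A)"
    using S.far_cmp[OF i p] S.far_idn[OF Ob(1)] pi by simp
  ultimately have c'0: "c' = \<zero>\<^sub>m Z (\<Sigma>\<^sub>o A)"
    using cmp_assoc[OF c' Si Sp] idn_cmp[OF c'] by simp
  obtain t where t: "t \<in> Hom C Z B" and tc: "t \<cdot> c = q"
    using dist_weak_cokernel[OF T q qi] by blast
  let ?s = "c \<cdot> j"
  have s: "?s \<in> Hom C B Z"
    by (rule cmp_Hom[OF j c])
  have st: "?s \<cdot> t \<in> Hom C Z Z"
    by (rule cmp_Hom[OF t s])
  have ts: "t \<cdot> ?s = \<one>\<^sub>m B"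
    using cmp_assoc[OF j c t] tc qj by simp
  have cD: "c \<cdot> (i \<cdot> p) = \<zero>\<^sub>m D Z"
    using cmp_assoc[OF p i c] dist_cmp_zero[OF T] pzero_cmp[OF p Z] by simp
  have "c = c \<cdot> (i \<cdot> p +\<^sub>m j \<cdot> q)"
    using sum cmp_idn[OF c] by simp
  also have "\<dots> = c \<cdot> (i \<cdot> p) +\<^sub>m c \<cdot> (j \<cdot> q)"
    by (rule cmp_padd[OF cmp_Hom[OF p i] cmp_Hom[OF q j] c])
  also have "\<dots> = c \<cdot> (j \<cdot> q)"
    using cD pzero_padd[OF cmp_Hom[OF cmp_Hom[OF q j] c]] by simp
  finally have stc: "(?s \<cdot> t) \<cdot> c = c"
    using cmp_assoc[OF q j c] cmp_assoc[OF c t s] tc by simp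
  have nst: "neg C (?s \<cdot> t) \<in> Hom C Z Z"
    by (rule neg_Hom[OF st])
  let ?e = "\<one>\<^sub>m Z +\<^sub>m neg C (?s \<cdot> t)"
  have e: "?e \<in> Hom C Z Z"
    by (rule padd_Hom[OF idn_Hom[OF Z] nst])
  have "?e \<cdot> c = c +\<^sub>m neg C (?s \<cdot> t) \<cdot> c"
    using padd_cmp[OF c idn_Hom[OF Z] nst] idn_cmp[OF c] by simp
  also have "\<dots> = \<zero>\<^sub>m D Z"
    using neg_cmp[OF c st] stc by simp
  finally obtain r where r: "r \<in> Hom C (\<Sigma>\<^sub>o A) Z" "r \<cdot> c' = ?e"
    using dist_weak_cokernel[OF dist_rotated[OF T] e] by blast
  then have "?e = \<zero>\<^sub>m Z Z"
    using c'0 cmp_pzero[OF r(1) Z] by simp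
  then have st1: "?s \<cdot> t = \<one>\<^sub>m Z"
    using padd_neg_cancel[OF idn_Hom[OF Z] st] by simp
  have "is_iso C ?s"
    using s t st1 ts unfolding is_iso_def by (auto simp: Hom_def)
  then have "isomorphic C B Z"
    using s unfolding isomorphic_def by blast
  then have "Z \<in> I"
    using I \<open>B \<in> I\<close> Z unfolding triangulated_subcategory_def iso_closed_def by blast
  then show ?thesis
    using I \<open>A \<in> I\<close> T unfolding triangulated_subcategory_def by blast
qed

lemma direct_sum_mem_iff:
  assumes "thick_subcategory C I" and "direct_sum C A B D"
  shows "D \<in> I \<longleftrightarrow> A \<in> I \<and> B \<in> I"
  using assms direct_sum_mem unfolding thick_subcategory_def by blast

end


section \<open>Monoidal triangulated categories\<close>

record ('o, 'm) mt_cat = "('o, 'm) tri_cat" +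
  tob :: "'o \<Rightarrow> 'o \<Rightarrow> 'o" (infixl "\<boxtimes>\<index>" 75)
  tar :: "'m \<Rightarrow> 'm \<Rightarrow> 'm" (infixl "\<boxtimes>\<^sub>m\<index>" 75)
  unt :: 'o ("\<I>\<index>")
  asc :: "'o \<Rightarrow> 'o \<Rightarrow> 'o \<Rightarrow> 'm" ("\<a>\<index>")
  lun :: "'o \<Rightarrow> 'm" ("\<l>\<index>")
  run :: "'o \<Rightarrow> 'm" ("\<r>\<index>")

locale monoidal_category = category K for K :: "('o, 'm, 'z) mt_cat_scheme" (structure) +
  assumes tob_Ob: "A \<in> Ob K \<Longrightarrow> B \<in> Ob K \<Longrightarrow> A \<boxtimes> B \<in> Ob K"
    and tar_Hom: "f \<in> Hom K A B \<Longrightarrow> f' \<in> Hom K A' B' \<Longrightarrow> f \<boxtimes>\<^sub>m f' \<in> Hom K (A \<boxtimes> A') (B \<boxtimes> B')"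
    and tar_idn: "A \<in> Ob K \<Longrightarrow> B \<in> Ob K \<Longrightarrow> \<one>\<^sub>m A \<boxtimes>\<^sub>m \<one>\<^sub>m B = \<one>\<^sub>m (A \<boxtimes> B)"
    and tar_cmp: "f \<in> Hom K A B \<Longrightarrow> g \<in> Hom K B D \<Longrightarrow> f' \<in> Hom K A' B' \<Longrightarrow> g' \<in> Hom K B' D' \<Longrightarrow>
      (g \<cdot> f) \<boxtimes>\<^sub>m (g' \<cdot> f') = (g \<boxtimes>\<^sub>m g') \<cdot> (f \<boxtimes>\<^sub>m f')"
    and unt_Ob: "\<I> \<in> Ob K"
    and asc_iso: "A \<in> Ob K \<Longrightarrow> B \<in> Ob K \<Longrightarrow> D \<in> Ob K \<Longrightarrow>
      \<a> A B D \<in> Hom K (A \<boxtimes> B \<boxtimes> D) (A \<boxtimes> (B \<boxtimes> D)) \<and> is_iso K (\<a> A B D)"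
    and asc_natural: "f \<in> Hom K A A' \<Longrightarrow> g \<in> Hom K B B' \<Longrightarrow> h \<in> Hom K D D' \<Longrightarrow>
      \<a> A' B' D' \<cdot> (f \<boxtimes>\<^sub>m g \<boxtimes>\<^sub>m h) = (f \<boxtimes>\<^sub>m (g \<boxtimes>\<^sub>m h)) \<cdot> \<a> A B D"
    and lun_iso: "A \<in> Ob K \<Longrightarrow> \<l> A \<in> Hom K (\<I> \<boxtimes> A) A \<and> is_iso K (\<l> A)"
    and lun_natural: "f \<in> Hom K A B \<Longrightarrow> \<l> B \<cdot> (\<one>\<^sub>m \<I> \<boxtimes>\<^sub>m f) = f \<cdot> \<l> A"
    and run_iso: "A \<in> Ob K \<Longrightarrow> \<r> A \<in> Hom K (A \<boxtimes> \<I>) A \<and> is_iso K (\<r> A)"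
    and run_natural: "f \<in> Hom K A B \<Longrightarrow> \<r> B \<cdot> (f \<boxtimes>\<^sub>m \<one>\<^sub>m \<I>) = f \<cdot> \<r> A"
    and pentagon: "A \<in> Ob K \<Longrightarrow> B \<in> Ob K \<Longrightarrow> D \<in> Ob K \<Longrightarrow> E \<in> Ob K \<Longrightarrow>
      \<a> A B (D \<boxtimes> E) \<cdot> \<a> (A \<boxtimes> B) D E =
      (\<one>\<^sub>m A \<boxtimes>\<^sub>m \<a> B D E) \<cdot> \<a> A (B \<boxtimes> D) E \<cdot> (\<a> A B D \<boxtimes>\<^sub>m \<one>\<^sub>m E)"
    and triangle_identity: "A \<in> Ob K \<Longrightarrow> B \<in> Ob K \<Longrightarrow>
      (\<one>\<^sub>m A \<boxtimes>\<^sub>m \<l> B) \<cdot> \<a> A \<I> B = \<r> A \<boxtimes>\<^sub>m \<one>\<^sub>m B"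

definition tensor_left :: "('o, 'm, 'z) mt_cat_scheme \<Rightarrow> 'o \<Rightarrow> ('o, 'm) endofun" where
  "tensor_left K A = \<lparr>fob = (\<lambda>B. tob K A B), far = (\<lambda>f. tar K (idn K A) f)\<rparr>"

definition tensor_right :: "('o, 'm, 'z) mt_cat_scheme \<Rightarrow> 'o \<Rightarrow> ('o, 'm) endofun" where
  "tensor_right K A = \<lparr>fob = (\<lambda>B. tob K B A), far = (\<lambda>f. tar K f (idn K A))\<rparr>"

locale monoidal_triangulated_category = triangulated_category K + monoidal_category K
  for K :: "('o, 'm, 'z) mt_cat_scheme" (structure) +
  assumes tensor_left_exact: "A \<in> Ob K \<Longrightarrow> exact_functor K (tensor_left K A)"
    and tensor_right_exact: "A \<in> Ob K \<Longrightarrow> exact_functor K (tensor_right K A)"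

text \<open>\<open>left_dual K A B\<close>: the object \<open>B\<close> is a left dual of \<open>A\<close>, with evaluation
  \<open>B \<otimes> A \<rightarrow> \<I>\<close> and coevaluation \<open>\<I> \<rightarrow> A \<otimes> B\<close>, i.e. the composites
  \<open>A \<cong> \<I> \<otimes> A \<rightarrow> (A \<otimes> B) \<otimes> A \<cong> A \<otimes> (B \<otimes> A) \<rightarrow> A \<otimes> \<I> \<cong> A\<close> and
  \<open>B \<cong> B \<otimes> \<I> \<rightarrow> B \<otimes> (A \<otimes> B) \<cong> (B \<otimes> A) \<otimes> B \<rightarrow> \<I> \<otimes> B \<cong> B\<close> are identities.\<close>

definition left_dual :: "('o, 'm, 'z) mt_cat_scheme \<Rightarrow> 'o \<Rightarrow> 'o \<Rightarrow> bool" where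
  "left_dual K A B \<longleftrightarrow> A \<in> Ob K \<and> B \<in> Ob K \<and>
     (\<exists>ev \<in> Hom K (B \<boxtimes>\<^bsub>K\<^esub> A) \<I>\<^bsub>K\<^esub>. \<exists>co \<in> Hom K \<I>\<^bsub>K\<^esub> (A \<boxtimes>\<^bsub>K\<^esub> B).
        \<r>\<^bsub>K\<^esub> A \<cdot>\<^bsub>K\<^esub> (\<one>\<^sub>m\<^bsub>K\<^esub> A \<boxtimes>\<^sub>m\<^bsub>K\<^esub> ev) \<cdot>\<^bsub>K\<^esub> \<a>\<^bsub>K\<^esub> A B A \<cdot>\<^bsub>K\<^esub> (co \<boxtimes>\<^sub>m\<^bsub>K\<^esub> \<one>\<^sub>m\<^bsub>K\<^esub> A) \<cdot>\<^bsub>K\<^esub>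
          inv_ar K (\<l>\<^bsub>K\<^esub> A) = \<one>\<^sub>m\<^bsub>K\<^esub> A \<and>
        \<l>\<^bsub>K\<^esub> B \<cdot>\<^bsub>K\<^esub> (ev \<boxtimes>\<^sub>m\<^bsub>K\<^esub> \<one>\<^sub>m\<^bsub>K\<^esub> B) \<cdot>\<^bsub>K\<^esub> inv_ar K (\<a>\<^bsub>K\<^esub> B A B) \<cdot>\<^bsub>K\<^esub>
          (\<one>\<^sub>m\<^bsub>K\<^esub> B \<boxtimes>\<^sub>m\<^bsub>K\<^esub> co) \<cdot>\<^bsub>K\<^esub> inv_ar K (\<r>\<^bsub>K\<^esub> B) = \<one>\<^sub>m\<^bsub>K\<^esub> B)"

text \<open>A right dual \<open>B\<close> of \<open>A\<close> has evaluation \<open>A \<otimes> B \<rightarrow> \<I>\<close> and coevaluation \<open>\<I> \<rightarrow> B \<otimes> A\<close>.\<close>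

definition right_dual :: "('o, 'm, 'z) mt_cat_scheme \<Rightarrow> 'o \<Rightarrow> 'o \<Rightarrow> bool" where
  "right_dual K A B \<longleftrightarrow> left_dual K B A"

definition left_rigid :: "('o, 'm, 'z) mt_cat_scheme \<Rightarrow> bool" where
  "left_rigid K \<longleftrightarrow> (\<forall>A \<in> Ob K. \<exists>B. left_dual K A B)"

definition right_rigid :: "('o, 'm, 'z) mt_cat_scheme \<Rightarrow> bool" where
  "right_rigid K \<longleftrightarrow> (\<forall>A \<in> Ob K. \<exists>B. right_dual K A B)"


section \<open>Group actions\<close>

text \<open>A monoidal triangulated endofunctor \<open>F\<close> carries isomorphisms
  \<open>\<mu> A B : F A \<otimes> F B \<rightarrow> F (A \<otimes> B)\<close>, \<open>\<epsilon> : \<I> \<rightarrow> F \<I>\<close> and \<open>\<phi> A : F (\<Sigma> A) \<rightarrow> \<Sigma> (F A)\<close>.\<close>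

record ('o, 'm) mt_fun = "('o, 'm) endofun" +
  fmu :: "'o \<Rightarrow> 'o \<Rightarrow> 'm"
  feps :: 'm
  fphi :: "'o \<Rightarrow> 'm"

locale monoidal_triangulated_functor = monoidal_triangulated_category K + endofunctor K F
  for K :: "('o, 'm, 'z) mt_cat_scheme" (structure) and F :: "('o, 'm, 'y) mt_fun_scheme" +
  assumes triangulated: "triangulated_functor K F (fphi F)"
    and fmu_iso: "A \<in> Ob K \<Longrightarrow> B \<in> Ob K \<Longrightarrow>
      fmu F A B \<in> Hom K (fob F A \<boxtimes> fob F B) (fob F (A \<boxtimes> B)) \<and> is_iso K (fmu F A B)"
    and fmu_natural: "f \<in> Hom K A A' \<Longrightarrow> g \<in> Hom K B B' \<Longrightarrow>
      fmu F A' B' \<cdot> (far F f \<boxtimes>\<^sub>m far F g) = far F (f \<boxtimes>\<^sub>m g) \<cdot> fmu F A B"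
    and feps_iso: "feps F \<in> Hom K \<I> (fob F \<I>) \<and> is_iso K (feps F)"
    and fmu_asc: "A \<in> Ob K \<Longrightarrow> B \<in> Ob K \<Longrightarrow> D \<in> Ob K \<Longrightarrow>
      far F (\<a> A B D) \<cdot> fmu F (A \<boxtimes> B) D \<cdot> (fmu F A B \<boxtimes>\<^sub>m \<one>\<^sub>m (fob F D)) =
      fmu F A (B \<boxtimes> D) \<cdot> (\<one>\<^sub>m (fob F A) \<boxtimes>\<^sub>m fmu F B D) \<cdot> \<a> (fob F A) (fob F B) (fob F D)"
    and fmu_lun: "A \<in> Ob K \<Longrightarrow>
      far F (\<l> A) \<cdot> fmu F \<I> A \<cdot> (feps F \<boxtimes>\<^sub>m \<one>\<^sub>m (fob F A)) = \<l> (fob F A)"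
    and fmu_run: "A \<in> Ob K \<Longrightarrow>
      far F (\<r> A) \<cdot> fmu F A \<I> \<cdot> (\<one>\<^sub>m (fob F A) \<boxtimes>\<^sub>m feps F) = \<r> (fob F A)"

definition mt_comp :: "('o, 'm, 'z) mt_cat_scheme \<Rightarrow>
    ('o, 'm) mt_fun \<Rightarrow> ('o, 'm) mt_fun \<Rightarrow> ('o, 'm) mt_fun" where
  "mt_comp K F H =
     \<lparr>fob = (\<lambda>A. fob F (fob H A)),
      far = (\<lambda>f. far F (far H f)),
      fmu = (\<lambda>A B. cmp K (far F (fmu H A B)) (fmu F (fob H A) (fob H B))),
      feps = cmp K (far F (feps H)) (feps F),
      fphi = (\<lambda>A. cmp K (fphi F (fob H A)) (far F (fphi H A)))\<rparr>"

definition mt_nat_iso :: "('o, 'm, 'z) mt_cat_scheme \<Rightarrow>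
    ('o, 'm) mt_fun \<Rightarrow> ('o, 'm) mt_fun \<Rightarrow> ('o \<Rightarrow> 'm) \<Rightarrow> bool" where
  "mt_nat_iso K F H \<eta> \<longleftrightarrow> nat_iso K F H \<eta> \<and>
     (\<forall>A \<in> Ob K. \<forall>B \<in> Ob K.
        cmp K (\<eta> (tob K A B)) (fmu F A B) = cmp K (fmu H A B) (tar K (\<eta> A) (\<eta> B))) \<and>
     cmp K (\<eta> (unt K)) (feps F) = feps H \<and>
     (\<forall>A \<in> Ob K.
        cmp K (shift_ar K (\<eta> A)) (fphi F A) = cmp K (fphi H A) (\<eta> (shift_ob K A)))"

locale group_action = group G + monoidal_triangulated_category K
  for G :: "('g, 'x) monoid_scheme" and K :: "('o, 'm, 'z) mt_cat_scheme" +
  fixes T :: "'g \<Rightarrow> ('o, 'm) mt_fun"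
    and \<gamma> :: "'g \<Rightarrow> 'g \<Rightarrow> 'o \<Rightarrow> 'm"
  assumes T_functor: "g \<in> carrier G \<Longrightarrow> monoidal_triangulated_functor K (T g)"
    and T_autoequivalence: "g \<in> carrier G \<Longrightarrow> autoequivalence K (T g)"
    and \<gamma>_iso: "g \<in> carrier G \<Longrightarrow> h \<in> carrier G \<Longrightarrow>
      mt_nat_iso K (mt_comp K (T g) (T h)) (T (g \<otimes>\<^bsub>G\<^esub> h)) (\<gamma> g h)"
    and \<gamma>_coherence: "g \<in> carrier G \<Longrightarrow> h \<in> carrier G \<Longrightarrow> k \<in> carrier G \<Longrightarrow> A \<in> Ob K \<Longrightarrow>
      \<gamma> g (h \<otimes>\<^bsub>G\<^esub> k) A \<cdot>\<^bsub>K\<^esub> far (T g) (\<gamma> h k A) =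
      \<gamma> (g \<otimes>\<^bsub>G\<^esub> h) k A \<cdot>\<^bsub>K\<^esub> \<gamma> g h (fob (T k) A)"


section \<open>Ideals, spectra and supports\<close>

definition thick_ideal :: "('o, 'm, 'z) mt_cat_scheme \<Rightarrow> 'o set \<Rightarrow> bool" where
  "thick_ideal K I \<longleftrightarrow> thick_subcategory K I \<and>
     (\<forall>A \<in> I. \<forall>B \<in> Ob K. tob K A B \<in> I \<and> tob K B A \<in> I)"

definition tensor_set :: "('o, 'm, 'z) mt_cat_scheme \<Rightarrow> 'o set \<Rightarrow> 'o set \<Rightarrow> 'o set" where
  "tensor_set K I J = {tob K A B | A B. A \<in> I \<and> B \<in> J}"

definition prime_ideal :: "('o, 'm, 'z) mt_cat_scheme \<Rightarrow> 'o set \<Rightarrow> bool" where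
  "prime_ideal K P \<longleftrightarrow> thick_ideal K P \<and> P \<noteq> Ob K \<and>
     (\<forall>I J. thick_ideal K I \<and> thick_ideal K J \<and> tensor_set K I J \<subseteq> P \<longrightarrow> I \<subseteq> P \<or> J \<subseteq> P)"

definition Spc :: "('o, 'm, 'z) mt_cat_scheme \<Rightarrow> 'o set set" where
  "Spc K = {P. prime_ideal K P}"

definition V :: "('o, 'm, 'z) mt_cat_scheme \<Rightarrow> 'o set \<Rightarrow> 'o set set" where
  "V K S = {P \<in> Spc K. S \<inter> P = {}}"

definition G_ideal :: "('g, 'x) monoid_scheme \<Rightarrow> ('o, 'm, 'z) mt_cat_scheme \<Rightarrow>
    ('g \<Rightarrow> ('o, 'm) mt_fun) \<Rightarrow> 'o set \<Rightarrow> bool" where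
  "G_ideal G K T I \<longleftrightarrow> thick_ideal K I \<and> (\<forall>g \<in> carrier G. fob (T g) ` I \<subseteq> I)"

definition G_prime :: "('g, 'x) monoid_scheme \<Rightarrow> ('o, 'm, 'z) mt_cat_scheme \<Rightarrow>
    ('g \<Rightarrow> ('o, 'm) mt_fun) \<Rightarrow> 'o set \<Rightarrow> bool" where
  "G_prime G K T Q \<longleftrightarrow> G_ideal G K T Q \<and> Q \<noteq> Ob K \<and>
     (\<forall>I J. G_ideal G K T I \<and> G_ideal G K T J \<and> tensor_set K I J \<subseteq> Q \<longrightarrow> I \<subseteq> Q \<or> J \<subseteq> Q)"

definition G_Spc :: "('g, 'x) monoid_scheme \<Rightarrow> ('o, 'm, 'z) mt_cat_scheme \<Rightarrow>
    ('g \<Rightarrow> ('o, 'm) mt_fun) \<Rightarrow> 'o set set" where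
  "G_Spc G K T = {Q. G_prime G K T Q}"

definition V_G :: "('g, 'x) monoid_scheme \<Rightarrow> ('o, 'm, 'z) mt_cat_scheme \<Rightarrow>
    ('g \<Rightarrow> ('o, 'm) mt_fun) \<Rightarrow> 'o set \<Rightarrow> 'o set set" where
  "V_G G K T S = {Q \<in> G_Spc G K T. S \<inter> Q = {}}"

definition Spc_topology :: "('o, 'm, 'z) mt_cat_scheme \<Rightarrow> 'o set topology" where
  "Spc_topology K = topology (\<lambda>U. \<exists>S \<subseteq> Ob K. U = Spc K - V K S)"

definition G_Spc_topology :: "('g, 'x) monoid_scheme \<Rightarrow> ('o, 'm, 'z) mt_cat_scheme \<Rightarrow>
    ('g \<Rightarrow> ('o, 'm) mt_fun) \<Rightarrow> 'o set topology" where
  "G_Spc_topology G K T = topology (\<lambda>U. \<exists>S \<subseteq> Ob K. U = G_Spc G K T - V_G G K T S)"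

text \<open>The sets \<open>V K S\<close> and \<open>V_G G K T S\<close> really are the closed sets of these topologies.\<close>

lemma (in triangulated_category) istopology_spectrum:
  assumes thick: "\<And>P. P \<in> Sp \<Longrightarrow> thick_subcategory C P"
  shows "istopology (\<lambda>U. \<exists>S \<subseteq> Ob C. U = Sp - {P \<in> Sp. S \<inter> P = {}})"
proof -
  have inter: "\<exists>S \<subseteq> Ob C. U \<inter> W = Sp - {P \<in> Sp. S \<inter> P = {}}"
    if U: "\<exists>S \<subseteq> Ob C. U = Sp - {P \<in> Sp. S \<inter> P = {}}"
      and W: "\<exists>S \<subseteq> Ob C. W = Sp - {P \<in> Sp. S \<inter> P = {}}" for U W
  proof -
    obtain S where S: "S \<subseteq> Ob C" "U = Sp - {P \<in> Sp. S \<inter> P = {}}"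
      using U by blast
    obtain R where R: "R \<subseteq> Ob C" "W = Sp - {P \<in> Sp. R \<inter> P = {}}"
      using W by blast
    define D where "D = {D. \<exists>A \<in> S. \<exists>B \<in> R. direct_sum C A B D}"
    have "D \<subseteq> Ob C"
      by (auto simp: D_def direct_sum_def)
    moreover have "D \<inter> P = {} \<longleftrightarrow> S \<inter> P = {} \<or> R \<inter> P = {}" if P: "P \<in> Sp" for P
    proof
      show "S \<inter> P = {} \<or> R \<inter> P = {}" if DP: "D \<inter> P = {}"
      proof (rule ccontr)
        assume "\<not> ?thesis"
        then obtain A B where AB: "A \<in> S" "A \<in> P" "B \<in> R" "B \<in> P"
          by blast
        then obtain E where E: "direct_sum C A B E"
          using ex_direct_sum S(1) R(1) by blast
        then have "E \<in> P"
          using direct_sum_mem_iff[OF thick[OF P]] AB by blast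
        with AB E DP show False
          by (auto simp: D_def)
      qed
      show "D \<inter> P = {}" if "S \<inter> P = {} \<or> R \<inter> P = {}"
        using that direct_sum_mem_iff[OF thick[OF P]] by (auto simp: D_def)
    qed
    then have "U \<inter> W = Sp - {P \<in> Sp. D \<inter> P = {}}"
      unfolding S(2) R(2) by blast
    ultimately show ?thesis
      by blast
  qed
  have union: "\<exists>S \<subseteq> Ob C. \<Union>\<U> = Sp - {P \<in> Sp. S \<inter> P = {}}"
    if \<U>: "\<forall>U \<in> \<U>. \<exists>S \<subseteq> Ob C. U = Sp - {P \<in> Sp. S \<inter> P = {}}" for \<U>
  proof -
    obtain f where f: "\<And>U. U \<in> \<U> \<Longrightarrow> f U \<subseteq> Ob C \<and> U = Sp - {P \<in> Sp. f U \<inter> P = {}}"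
      using \<U> by metis
    have "\<Union>\<U> = Sp - {P \<in> Sp. (\<Union>U \<in> \<U>. f U) \<inter> P = {}}"
    proof (rule Set.set_eqI)
      fix P
      have "P \<in> \<Union>\<U> \<longleftrightarrow> (\<exists>U \<in> \<U>. P \<in> Sp - {P \<in> Sp. f U \<inter> P = {}})"
        using f by blast
      then show "P \<in> \<Union>\<U> \<longleftrightarrow> P \<in> Sp - {P \<in> Sp. (\<Union>U \<in> \<U>. f U) \<inter> P = {}}"
        by blast
    qed
    moreover have "(\<Union>U \<in> \<U>. f U) \<subseteq> Ob C"
      using f by blast
    ultimately show ?thesis
      by blast
  qed
  define L where "L = (\<lambda>U. \<exists>S \<subseteq> Ob C. U = Sp - {P \<in> Sp. S \<inter> P = {}})"
  have "L (U \<inter> W)" if "L U" "L W" for U W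
    using inter[of U W] that by (simp only: L_def)
  moreover have "L (\<Union>\<U>)" if "\<forall>U \<in> \<U>. L U" for \<U>
    using union[of \<U>] that by (simp only: L_def)
  ultimately have "istopology L"
    unfolding istopology_def by blast
  then show ?thesis
    unfolding L_def .
qed

lemma (in triangulated_category) closedin_spectrum:
  assumes thick: "\<And>P. P \<in> Sp \<Longrightarrow> thick_subcategory C P"
  shows "closedin (topology (\<lambda>U. \<exists>S \<subseteq> Ob C. U = Sp - {P \<in> Sp. S \<inter> P = {}})) Z \<longleftrightarrow>
    (\<exists>S \<subseteq> Ob C. Z = {P \<in> Sp. S \<inter> P = {}})"
proof -
  define L where "L = (\<lambda>U. \<exists>S \<subseteq> Ob C. U = Sp - {P \<in> Sp. S \<inter> P = {}})"
  have "istopology L"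
    unfolding L_def by (rule istopology_spectrum[OF thick])
  then have op: "openin (topology L) = L"
    by (rule topology_inverse')
  have "Ob C \<inter> P \<noteq> {}" if "P \<in> Sp" for P
    using thick[OF that]
    unfolding thick_subcategory_def triangulated_subcategory_def iso_closed_def by blast
  then have "{P \<in> Sp. Ob C \<inter> P = {}} = {}"
    by blast
  then have "L Sp"
    unfolding L_def by (intro exI[of _ "Ob C"]) blast
  moreover have "U \<subseteq> Sp" if "L U" for U
    using that unfolding L_def by blast
  ultimately have top: "topspace (topology L) = Sp"
    unfolding topspace_def op by blast
  have "Z \<subseteq> Sp \<and> L (Sp - Z) \<longleftrightarrow> (\<exists>S \<subseteq> Ob C. Z = {P \<in> Sp. S \<inter> P = {}})"
  proof
    assume Z: "Z \<subseteq> Sp \<and> L (Sp - Z)"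
    then obtain S where "S \<subseteq> Ob C" "Sp - Z = Sp - {P \<in> Sp. S \<inter> P = {}}"
      unfolding L_def by blast
    moreover from this Z have "Z = {P \<in> Sp. S \<inter> P = {}}"
      by blast
    ultimately show "\<exists>S \<subseteq> Ob C. Z = {P \<in> Sp. S \<inter> P = {}}"
      by blast
  next
    assume "\<exists>S \<subseteq> Ob C. Z = {P \<in> Sp. S \<inter> P = {}}"
    then show "Z \<subseteq> Sp \<and> L (Sp - Z)"
      unfolding L_def by blast
  qed
  then have "closedin (topology L) Z \<longleftrightarrow> (\<exists>S \<subseteq> Ob C. Z = {P \<in> Sp. S \<inter> P = {}})"
    unfolding closedin_def top op .
  then show ?thesis
    unfolding L_def .
qed

lemma (in monoidal_triangulated_category) closedin_Spc_topology:
  "closedin (Spc_topology K) Z \<longleftrightarrow> (\<exists>S \<subseteq> Ob K. Z = V K S)"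
  unfolding Spc_topology_def V_def
  by (rule closedin_spectrum) (simp add: Spc_def prime_ideal_def thick_ideal_def)

lemma (in monoidal_triangulated_category) closedin_G_Spc_topology:
  "closedin (G_Spc_topology G K T) Z \<longleftrightarrow> (\<exists>S \<subseteq> Ob K. Z = V_G G K T S)"
  unfolding G_Spc_topology_def V_G_def
  by (rule closedin_spectrum) (simp add: G_Spc_def G_prime_def G_ideal_def thick_ideal_def)

definition noetherian_space :: "'a topology \<Rightarrow> bool" where
  "noetherian_space X \<longleftrightarrow>
     (\<forall>C :: nat \<Rightarrow> 'a set. (\<forall>n. closedin X (C n)) \<and> decseq C \<longrightarrow> (\<exists>N. \<forall>n \<ge> N. C n = C N))"

definition specialization_closed :: "'a topology \<Rightarrow> 'a set \<Rightarrow> bool" where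
  "specialization_closed X S \<longleftrightarrow> (\<exists>\<C>. (\<forall>C \<in> \<C>. closedin X C) \<and> S = \<Union>\<C>)"

definition G_support :: "('g, 'x) monoid_scheme \<Rightarrow> ('o, 'm, 'z) mt_cat_scheme \<Rightarrow>
    ('g \<Rightarrow> ('o, 'm) mt_fun) \<Rightarrow> 'o set \<Rightarrow> 'o set set" where
  "G_support G K T I = (\<Union>A \<in> I. V_G G K T {A})"

end

theory Submission
  imports Defs
begin

text \<open>The support \<open>\<Phi>\<^sub>G I\<close> is the set of \<open>G\<close>-primes that do not contain \<open>I\<close>. So \<open>\<Phi>\<^sub>G\<close> is injective as soon
  as every \<open>G\<close>-ideal is an intersection of \<open>G\<close>-primes, and it reaches every specialization-closed
  set as soon as each \<open>G\<close>-prime \<open>Q\<close> has an object \<open>E \<notin> Q\<close> whose support \<open>V\<^sup>G E\<close> lies in the closure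
  \<open>{Q'. Q' \<subseteq> Q}\<close> of \<open>Q\<close>: the ideal that belongs to a set \<open>W\<close> is then the intersection of the
  \<open>G\<close>-primes outside \<open>W\<close>.

  Both facts come from ordinary primes through the \<open>G\<close>-core of \<open>P\<close>, the largest \<open>G\<close>-ideal inside \<open>P\<close>,
  which is \<open>G\<close>-prime when \<open>P\<close> is prime (\<open>G_core_prime\<close>).

  Separation uses rigidity: an object \<open>A\<close> with a dual \<open>B\<close> is a retract, hence a direct summand, of
  \<open>A \<otimes> B \<otimes> A\<close>. Therefore a thick ideal that is maximal among those avoiding \<open>A\<close> is already prime,
  and Zorn's lemma separates any thick ideal from any object outside it (\<open>separating_prime_exists\<close>).
  Taking cores separates \<open>G\<close>-ideals by \<open>G\<close>-primes.

  The object \<open>E\<close> uses that \<open>Spc K\<close> is Noetherian (\<open>G_prime_closure_support\<close>): among the closed sets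
  \<open>V E\<close> with \<open>E \<notin> Q\<close> take a minimal one. If \<open>B \<notin> Q\<close>, then since \<open>Q\<close> is \<open>G\<close>-prime some \<open>E \<otimes> Y\<close> with \<open>Y\<close> in
  the \<open>G\<close>-ideal generated by \<open>B\<close> is outside \<open>Q\<close>, and minimality gives \<open>V (E \<otimes> Y) = V E\<close>. Thus no prime
  in \<open>V E\<close> has \<open>B\<close> in its core; as \<open>B\<close> was arbitrary, all these cores lie in \<open>Q\<close>. A \<open>G\<close>-prime that
  avoids \<open>E\<close> is contained in the core of some prime in \<open>V E\<close>, hence in \<open>Q\<close>.\<close>

section \<open>Isomorphic objects and retracts\<close>

context category
begin

lemma isomorphic_sym:
  assumes "isomorphic C A B"
  shows "isomorphic C B A"
proof -
  obtain f g where f: "f \<in> Hom C A B" and g: "g \<in> Hom C B A"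
    and gf: "g \<cdot> f = \<one>\<^sub>m A" and fg: "f \<cdot> g = \<one>\<^sub>m B"
    using assms unfolding isomorphic_def is_iso_def by (auto simp: Hom_def)
  then have "is_iso C g"
    unfolding is_iso_def by (auto simp: Hom_def)
  then show ?thesis
    using g unfolding isomorphic_def by blast
qed

lemma iso_closed_mem_iff:
  assumes "iso_closed C I" and "isomorphic C A B"
  shows "A \<in> I \<longleftrightarrow> B \<in> I"
proof -
  have "A \<in> Ob C" "B \<in> Ob C"
    using assms(2) src_Ob trg_Ob unfolding isomorphic_def Hom_def by auto
  then show ?thesis
    using assms isomorphic_sym unfolding iso_closed_def by blast
qed

lemma inv_ar_Hom:
  assumes f: "f \<in> Hom C A B" and "is_iso C f"
  shows "inv_ar C f \<in> Hom C B A"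
proof -
  have st: "src C f = A" "trg C f = B"
    using f by (auto simp: Hom_def)
  obtain g where g: "g \<in> Hom C B A" "g \<cdot> f = \<one>\<^sub>m A" "f \<cdot> g = \<one>\<^sub>m B"
    using assms(2) unfolding is_iso_def st by blast
  have "h = g" if "h \<in> Hom C B A" "h \<cdot> f = \<one>\<^sub>m A" for h
    using cmp_assoc[OF g(1) f that(1)] g(3) that(2) cmp_idn[OF that(1)] idn_cmp[OF g(1)] by simp
  then have "inv_ar C f = g"
    unfolding inv_ar_def st using g by blast
  then show ?thesis
    using g(1) by simp
qed

end

lemma (in endofunctor) far_isomorphic:
  assumes "isomorphic C A B"
  shows "isomorphic C (fob F A) (fob F B)"
proof -
  obtain f g where f: "f \<in> Hom C A B" and g: "g \<in> Hom C B A"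
    and gf: "g \<cdot> f = \<one>\<^sub>m A" and fg: "f \<cdot> g = \<one>\<^sub>m B"
    using assms unfolding isomorphic_def is_iso_def by (auto simp: Hom_def)
  have "A \<in> Ob C" "B \<in> Ob C"
    using f src_Ob trg_Ob by (auto simp: Hom_def)
  then have "far F g \<cdot> far F f = \<one>\<^sub>m (fob F A)" "far F f \<cdot> far F g = \<one>\<^sub>m (fob F B)"
    using far_cmp[OF f g] far_cmp[OF g f] gf fg far_idn by simp_all
  then have "is_iso C (far F f)"
    using far_Hom[OF f] far_Hom[OF g] unfolding is_iso_def by (auto simp: Hom_def)
  then show ?thesis
    using far_Hom[OF f] unfolding isomorphic_def by blast
qed

lemma nat_iso_isomorphic:
  "nat_iso C F H \<eta> \<Longrightarrow> A \<in> Ob C \<Longrightarrow> isomorphic C (fob F A) (fob H A)"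
  unfolding nat_iso_def isomorphic_def by blast

context triangulated_category
begin

text \<open>Complete \<open>i\<close> to a triangle \<open>A \<rightarrow> D \<rightarrow> Z \<rightarrow> \<Sigma>A\<close>. Since \<open>\<Sigma>i\<close> is a split monomorphism, the map
  \<open>Z \<rightarrow> \<Sigma>A\<close> vanishes, so \<open>D \<rightarrow> Z\<close> is an epimorphism; it is split by the factorization of the
  complementary idempotent \<open>1 - i p\<close> through it.\<close>

lemma retract_direct_sum:
  assumes i: "i \<in> Hom C A D" and p: "p \<in> Hom C D A" and pi: "p \<cdot> i = \<one>\<^sub>m A"
  shows "\<exists>Z. direct_sum C A Z D"
proof -
  interpret S: endofunctor C "shift C"
    by (rule endofunctor_shift)
  obtain Z c c' where T: "dist_triangle C A D Z i c c'"
    using dist_complete[OF i] by blast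
  then have c: "c \<in> Hom C D Z" and c': "c' \<in> Hom C Z (\<Sigma>\<^sub>o A)"
    and Ob: "A \<in> Ob C" "D \<in> Ob C" "Z \<in> Ob C"
    by (auto simp: dist_triangle_def triangle_def)
  have Si: "\<Sigma>\<^sub>m i \<in> Hom C (\<Sigma>\<^sub>o A) (\<Sigma>\<^sub>o D)" and Sp: "\<Sigma>\<^sub>m p \<in> Hom C (\<Sigma>\<^sub>o D) (\<Sigma>\<^sub>o A)"
    using S.far_Hom i p by auto
  have ci: "c \<cdot> i = \<zero>\<^sub>m A Z"
    by (rule dist_cmp_zero[OF T])
  have "neg C (\<Sigma>\<^sub>m i) \<cdot> c' = \<zero>\<^sub>m Z (\<Sigma>\<^sub>o D)"
    by (rule dist_cmp_zero[OF dist_rotated[OF dist_rotated[OF T]]])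
  then have "\<Sigma>\<^sub>m i \<cdot> c' = \<zero>\<^sub>m Z (\<Sigma>\<^sub>o D)"
    using neg_cmp[OF c' Si] padd_pzero[OF cmp_Hom[OF c' Si]] by simp
  then have "\<Sigma>\<^sub>m p \<cdot> (\<Sigma>\<^sub>m i \<cdot> c') = \<zero>\<^sub>m Z (\<Sigma>\<^sub>o A)"
    using cmp_pzero[OF Sp Ob(3)] by simp
  moreover have "\<Sigma>\<^sub>m p \<cdot> \<Sigma>\<^sub>m i = \<one>\<^sub>m (\<Sigma>\<^sub>o A)"
    using S.far_cmp[OF i p] S.far_idn[OF Ob(1)] pi by simp
  ultimately have c'0: "c' = \<zero>\<^sub>m Z (\<Sigma>\<^sub>o A)"
    using cmp_assoc[OF c' Si Sp] idn_cmp[OF c'] by simp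
  have epi0: "u = \<zero>\<^sub>m Z W" if u: "u \<in> Hom C Z W" "u \<cdot> c = \<zero>\<^sub>m D W" for u W
  proof -
    obtain r where r: "r \<in> Hom C (\<Sigma>\<^sub>o A) W" "r \<cdot> c' = u"
      using dist_weak_cokernel[OF dist_rotated[OF T] u] by blast
    then show ?thesis
      using c'0 cmp_pzero[OF r(1) Ob(3)] by simp
  qed
  have epi: "u = v" if u: "u \<in> Hom C Z W" and v: "v \<in> Hom C Z W" and eq: "u \<cdot> c = v \<cdot> c" for u v W
  proof -
    have "(u +\<^sub>m neg C v) \<cdot> c = \<zero>\<^sub>m D W"
      using padd_cmp[OF c u neg_Hom[OF v]] neg_cmp[OF c v] eq by simp
    then show ?thesis
      using epi0[OF padd_Hom[OF u neg_Hom[OF v]]] padd_neg_cancel[OF u v] by blast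
  qed
  have ip: "i \<cdot> p \<in> Hom C D D"
    by (rule cmp_Hom[OF p i])
  let ?e = "\<one>\<^sub>m D +\<^sub>m neg C (i \<cdot> p)"
  have nip: "neg C (i \<cdot> p) \<in> Hom C D D"
    by (rule neg_Hom[OF ip])
  have e: "?e \<in> Hom C D D"
    by (rule padd_Hom[OF idn_Hom[OF Ob(2)] nip])
  have ipi: "(i \<cdot> p) \<cdot> i = i"
    using cmp_assoc[OF i p i] pi cmp_idn[OF i] by simp
  have "?e \<cdot> i = i +\<^sub>m neg C (i \<cdot> p) \<cdot> i"
    using padd_cmp[OF i idn_Hom[OF Ob(2)] nip] idn_cmp[OF i] by simp
  then have "?e \<cdot> i = \<zero>\<^sub>m A D"
    using neg_cmp[OF i ip] ipi by simp
  then obtain j where j: "j \<in> Hom C Z D" and jc: "j \<cdot> c = ?e"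
    using dist_weak_cokernel[OF T e] by blast
  have sum: "i \<cdot> p +\<^sub>m j \<cdot> c = \<one>\<^sub>m D"
  proof -
    interpret H: comm_group "Hom_group C D D"
      using Hom_comm_group Ob(2) by blast
    have simps: "carrier (Hom_group C D D) = Hom C D D"
      "x \<otimes>\<^bsub>Hom_group C D D\<^esub> y = x +\<^sub>m y" for x y
      by (simp_all add: Hom_group_def)
    have "i \<cdot> p +\<^sub>m ?e = \<one>\<^sub>m D +\<^sub>m (i \<cdot> p +\<^sub>m neg C (i \<cdot> p))"
      using H.m_lcomm[of "i \<cdot> p" "\<one>\<^sub>m D" "neg C (i \<cdot> p)"] ip nip idn_Hom[OF Ob(2)]
      unfolding simps by blast
    then show ?thesis
      using jc padd_neg[OF ip] padd_pzero[OF idn_Hom[OF Ob(2)]] by simp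
  qed
  have jcD: "j \<cdot> c \<in> Hom C D D"
    by (rule cmp_Hom[OF c j])
  have "c \<cdot> (i \<cdot> p) = \<zero>\<^sub>m D Z"
    using cmp_assoc[OF p i c] ci pzero_cmp[OF p Ob(3)] by simp
  then have "c \<cdot> (j \<cdot> c) = c"
    using cmp_padd[OF ip jcD c] sum cmp_idn[OF c] pzero_padd[OF cmp_Hom[OF jcD c]] by simp
  then have cj: "c \<cdot> j = \<one>\<^sub>m Z"
    using epi[OF cmp_Hom[OF j c] idn_Hom[OF Ob(3)]] cmp_assoc[OF c j c] idn_cmp[OF c] by simp
  have pip: "p \<cdot> (i \<cdot> p) = p"
    using cmp_assoc[OF p i p] pi idn_cmp[OF p] by simp
  have pjc: "p \<cdot> (j \<cdot> c) \<in> Hom C D A"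
    by (rule cmp_Hom[OF jcD p])
  have "p +\<^sub>m p \<cdot> (j \<cdot> c) = p"
    using cmp_padd[OF ip jcD p] sum cmp_idn[OF p] pip by simp
  \<comment> \<open>multiplied on the right by the idempotent \<open>j c\<close>, this becomes \<open>p j c + p j c = p j c\<close>\<close>
  then have "(p +\<^sub>m p \<cdot> (j \<cdot> c)) \<cdot> (j \<cdot> c) = p \<cdot> (j \<cdot> c)"
    by simp
  moreover have "(p \<cdot> (j \<cdot> c)) \<cdot> (j \<cdot> c) = p \<cdot> (j \<cdot> c)"
    using cmp_assoc[OF jcD jcD p] cmp_assoc[OF jcD c j] \<open>c \<cdot> (j \<cdot> c) = c\<close> by simp
  ultimately have "p \<cdot> (j \<cdot> c) +\<^sub>m p \<cdot> (j \<cdot> c) = p \<cdot> (j \<cdot> c)"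
    using padd_cmp[OF jcD p pjc] by simp
  then have "(p \<cdot> j) \<cdot> c = \<zero>\<^sub>m D A"
    using padd_idem[OF pjc] cmp_assoc[OF c j p] by simp
  then have "p \<cdot> j = \<zero>\<^sub>m Z A"
    using epi0[OF cmp_Hom[OF j p]] by blast
  then show ?thesis
    unfolding direct_sum_def using Ob i j p c pi cj ci sum by blast
qed

lemma thick_retract_mem:
  assumes "thick_subcategory C I" and "D \<in> I"
    and "i \<in> Hom C A D" and "p \<in> Hom C D A" and "p \<cdot> i = \<one>\<^sub>m A"
  shows "A \<in> I"
  using assms retract_direct_sum[OF assms(3-5)] unfolding thick_subcategory_def by blast

section \<open>Constructions of thick subcategories\<close>

lemma thick_Ob: "thick_subcategory C I \<Longrightarrow> I \<subseteq> Ob C"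
  unfolding thick_subcategory_def triangulated_subcategory_def iso_closed_def by blast

lemma thick_iso_closed: "thick_subcategory C I \<Longrightarrow> iso_closed C I"
  unfolding thick_subcategory_def triangulated_subcategory_def by blast

lemma thick_zero_mem:
  assumes "thick_subcategory C I" and Z: "zero_object C Z"
  shows "Z \<in> I"
proof -
  obtain Z' where Z': "Z' \<in> I" "zero_object C Z'"
    using assms(1) unfolding thick_subcategory_def triangulated_subcategory_def by blast
  have Ob: "Z \<in> Ob C" "Z' \<in> Ob C"
    using Z Z' by (auto simp: zero_object_def)
  have "\<zero>\<^sub>m Z' Z \<cdot> \<zero>\<^sub>m Z Z' = \<zero>\<^sub>m Z Z"
    using pzero_cmp pzero_Hom Ob by blast
  then show ?thesis
    using thick_retract_mem[OF assms(1) Z'(1) pzero_Hom[OF Ob] pzero_Hom[OF Ob(2,1)]]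
      Z by (simp add: zero_object_iff)
qed

lemma thickI:
  assumes "I \<subseteq> Ob C"
    and "\<And>A B. A \<in> I \<Longrightarrow> isomorphic C A B \<Longrightarrow> B \<in> Ob C \<Longrightarrow> B \<in> I"
    and "\<And>Z. zero_object C Z \<Longrightarrow> Z \<in> I"
    and "\<And>X. X \<in> Ob C \<Longrightarrow> X \<in> I \<longleftrightarrow> \<Sigma>\<^sub>o X \<in> I"
    and "\<And>X Y Z f g h. dist_triangle C X Y Z f g h \<Longrightarrow>
        (X \<in> I \<and> Y \<in> I \<longrightarrow> Z \<in> I) \<and> (Y \<in> I \<and> Z \<in> I \<longrightarrow> X \<in> I) \<and> (X \<in> I \<and> Z \<in> I \<longrightarrow> Y \<in> I)"
    and "\<And>A B D. direct_sum C A B D \<Longrightarrow> D \<in> I \<Longrightarrow> A \<in> I \<and> B \<in> I"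
  shows "thick_subcategory C I"
  using assms(1-4,6) assms(5) ex_zero_object
  unfolding thick_subcategory_def triangulated_subcategory_def iso_closed_def
  by (intro conjI ballI allI impI) blast+

lemma thickD:
  assumes "thick_subcategory C I"
  shows "X \<in> Ob C \<Longrightarrow> X \<in> I \<longleftrightarrow> \<Sigma>\<^sub>o X \<in> I"
    and "dist_triangle C X Y Z f g h \<Longrightarrow> X \<in> I \<Longrightarrow> Y \<in> I \<Longrightarrow> Z \<in> I"
    and "dist_triangle C X Y Z f g h \<Longrightarrow> Y \<in> I \<Longrightarrow> Z \<in> I \<Longrightarrow> X \<in> I"
    and "dist_triangle C X Y Z f g h \<Longrightarrow> X \<in> I \<Longrightarrow> Z \<in> I \<Longrightarrow> Y \<in> I"
  using assms unfolding thick_subcategory_def triangulated_subcategory_def by blast+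

lemma thick_INT:
  assumes I: "\<And>r. r \<in> R \<Longrightarrow> thick_subcategory C (I r)"
  shows "thick_subcategory C {A \<in> Ob C. \<forall>r \<in> R. A \<in> I r}"
proof (rule thickI)
  show "B \<in> {A \<in> Ob C. \<forall>r \<in> R. A \<in> I r}"
    if "A \<in> {A \<in> Ob C. \<forall>r \<in> R. A \<in> I r}" "isomorphic C A B" "B \<in> Ob C" for A B
    using that iso_closed_mem_iff[OF thick_iso_closed[OF I] that(2)] by blast
  show "Z \<in> {A \<in> Ob C. \<forall>r \<in> R. A \<in> I r}" if "zero_object C Z" for Z
    using that thick_zero_mem[OF I that] by (auto simp: zero_object_def)
  show "X \<in> {A \<in> Ob C. \<forall>r \<in> R. A \<in> I r} \<longleftrightarrow> \<Sigma>\<^sub>o X \<in> {A \<in> Ob C. \<forall>r \<in> R. A \<in> I r}"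
    if "X \<in> Ob C" for X
    using thickD(1)[OF I that] endofunctor.fob_Ob[OF endofunctor_shift that] that by blast
  show "A \<in> {A \<in> Ob C. \<forall>r \<in> R. A \<in> I r} \<and> B \<in> {A \<in> Ob C. \<forall>r \<in> R. A \<in> I r}"
    if "direct_sum C A B D" "D \<in> {A \<in> Ob C. \<forall>r \<in> R. A \<in> I r}" for A B D
    using that direct_sum_mem_iff[OF I that(1)] by (auto simp: direct_sum_def)
  fix X Y Z f g h
  assume T: "dist_triangle C X Y Z f g h"
  then have "X \<in> Ob C" "Y \<in> Ob C" "Z \<in> Ob C"
    by (auto simp: dist_triangle_def triangle_def)
  then show "(X \<in> {A \<in> Ob C. \<forall>r \<in> R. A \<in> I r} \<and> Y \<in> {A \<in> Ob C. \<forall>r \<in> R. A \<in> I r} \<longrightarrow>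
      Z \<in> {A \<in> Ob C. \<forall>r \<in> R. A \<in> I r}) \<and>
    (Y \<in> {A \<in> Ob C. \<forall>r \<in> R. A \<in> I r} \<and> Z \<in> {A \<in> Ob C. \<forall>r \<in> R. A \<in> I r} \<longrightarrow>
      X \<in> {A \<in> Ob C. \<forall>r \<in> R. A \<in> I r}) \<and>
    (X \<in> {A \<in> Ob C. \<forall>r \<in> R. A \<in> I r} \<and> Z \<in> {A \<in> Ob C. \<forall>r \<in> R. A \<in> I r} \<longrightarrow>
      Y \<in> {A \<in> Ob C. \<forall>r \<in> R. A \<in> I r})"
    using thickD(2-4)[OF I T] by blast
qed blast

lemma thick_Union_chain:
  assumes I: "\<And>I. I \<in> \<C> \<Longrightarrow> thick_subcategory C I" and ne: "\<C> \<noteq> {}"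
    and chain: "\<And>I J. I \<in> \<C> \<Longrightarrow> J \<in> \<C> \<Longrightarrow> I \<subseteq> J \<or> J \<subseteq> I"
  shows "thick_subcategory C (\<Union>\<C>)"
proof (rule thickI)
  have two: "\<exists>I \<in> \<C>. A \<in> I \<and> B \<in> I" if "A \<in> \<Union>\<C>" "B \<in> \<Union>\<C>" for A B
    using that chain by blast
  show "\<Union>\<C> \<subseteq> Ob C"
    using thick_Ob I by blast
  show "B \<in> \<Union>\<C>" if "A \<in> \<Union>\<C>" "isomorphic C A B" for A B
    using that iso_closed_mem_iff[OF thick_iso_closed[OF I] that(2)] by blast
  show "Z \<in> \<Union>\<C>" if "zero_object C Z" for Z
    using thick_zero_mem[OF I that] ne by blast
  show "X \<in> \<Union>\<C> \<longleftrightarrow> \<Sigma>\<^sub>o X \<in> \<Union>\<C>" if "X \<in> Ob C" for X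
    using thickD(1)[OF I that] by blast
  show "A \<in> \<Union>\<C> \<and> B \<in> \<Union>\<C>" if "direct_sum C A B D" "D \<in> \<Union>\<C>" for A B D
    using that direct_sum_mem_iff[OF I that(1)] by blast
  show "(X \<in> \<Union>\<C> \<and> Y \<in> \<Union>\<C> \<longrightarrow> Z \<in> \<Union>\<C>) \<and> (Y \<in> \<Union>\<C> \<and> Z \<in> \<Union>\<C> \<longrightarrow> X \<in> \<Union>\<C>) \<and>
      (X \<in> \<Union>\<C> \<and> Z \<in> \<Union>\<C> \<longrightarrow> Y \<in> \<Union>\<C>)" if T: "dist_triangle C X Y Z f g h" for X Y Z f g h
    using thickD(2-4)[OF I T] two by (meson Union_iff)
qed

lemma additive_functor_direct_sum:
  assumes "additive_functor C F" and "direct_sum C A B D"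
  shows "direct_sum C (fob F A) (fob F B) (fob F D)"
proof -
  interpret endofunctor C F
    using assms(1) by (simp add: additive_functor_def)
  have padd: "far F (f +\<^sub>m g) = far F f +\<^sub>m far F g" if "f \<in> Hom C X Y" "g \<in> Hom C X Y" for f g X Y
    using assms(1) that unfolding additive_functor_def by blast
  have pzero: "far F (\<zero>\<^sub>m X Y) = \<zero>\<^sub>m (fob F X) (fob F Y)" if "X \<in> Ob C" "Y \<in> Ob C" for X Y
  proof -
    have z: "\<zero>\<^sub>m X Y \<in> Hom C X Y"
      by (rule pzero_Hom[OF that])
    show ?thesis
      using padd_idem[OF far_Hom[OF z]] padd[OF z z] padd_pzero[OF z] by simp
  qed
  obtain i j p q where i: "i \<in> Hom C A D" and j: "j \<in> Hom C B D" and p: "p \<in> Hom C D A"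
    and q: "q \<in> Hom C D B" and eqs: "p \<cdot> i = \<one>\<^sub>m A" "q \<cdot> j = \<one>\<^sub>m B" "p \<cdot> j = \<zero>\<^sub>m B A"
      "q \<cdot> i = \<zero>\<^sub>m A B" "i \<cdot> p +\<^sub>m j \<cdot> q = \<one>\<^sub>m D"
    using assms(2) unfolding direct_sum_def by blast
  have Ob: "A \<in> Ob C" "B \<in> Ob C" "D \<in> Ob C"
    using assms(2) by (auto simp: direct_sum_def)
  have "far F p \<cdot> far F i = \<one>\<^sub>m (fob F A)" "far F q \<cdot> far F j = \<one>\<^sub>m (fob F B)"
    "far F p \<cdot> far F j = \<zero>\<^sub>m (fob F B) (fob F A)" "far F q \<cdot> far F i = \<zero>\<^sub>m (fob F A) (fob F B)"
    using far_cmp[OF i p] far_cmp[OF j q] far_cmp[OF j p] far_cmp[OF i q] eqs far_idn pzero Ob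
    by simp_all
  moreover have "far F i \<cdot> far F p +\<^sub>m far F j \<cdot> far F q = \<one>\<^sub>m (fob F D)"
    using far_cmp[OF p i] far_cmp[OF q j] padd[OF cmp_Hom[OF p i] cmp_Hom[OF q j]] eqs far_idn Ob
    by simp
  ultimately show ?thesis
    unfolding direct_sum_def using fob_Ob Ob far_Hom i j p q by blast
qed

lemma additive_functor_zero_object:
  assumes F: "additive_functor C F" and Z: "zero_object C Z"
  shows "zero_object C (fob F Z)"
proof -
  interpret endofunctor C F
    using F by (simp add: additive_functor_def)
  have Z': "Z \<in> Ob C" "\<one>\<^sub>m Z = \<zero>\<^sub>m Z Z"
    using Z by (auto simp: zero_object_iff)
  have 1: "\<one>\<^sub>m Z \<in> Hom C Z Z"
    by (rule idn_Hom[OF Z'(1)])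
  have "\<one>\<^sub>m Z +\<^sub>m \<one>\<^sub>m Z = \<one>\<^sub>m Z"
    using padd_pzero[OF 1] Z' by simp
  then have "\<one>\<^sub>m (fob F Z) +\<^sub>m \<one>\<^sub>m (fob F Z) = \<one>\<^sub>m (fob F Z)"
    using F 1 far_idn[OF Z'(1)] unfolding additive_functor_def by metis
  then show ?thesis
    using padd_idem idn_Hom fob_Ob[OF Z'(1)] by (simp add: zero_object_iff)
qed

text \<open>An exact functor commutes with the shift only up to isomorphism, which suffices because thick
  subcategories are closed under isomorphism.\<close>

lemma thick_preimage:
  assumes F: "exact_functor C F" and I: "thick_subcategory C I"
  shows "thick_subcategory C {A \<in> Ob C. fob F A \<in> I}"
proof -
  obtain \<phi> where add: "additive_functor C F"
    and \<phi>: "nat_iso C (comp_fun F (shift C)) (comp_fun (shift C) F) \<phi>"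
    and dist: "\<And>X Y Z f g h. dist_triangle C X Y Z f g h \<Longrightarrow>
      dist_triangle C (fob F X) (fob F Y) (fob F Z) (far F f) (far F g) (\<phi> X \<cdot> far F h)"
    using F unfolding exact_functor_def triangulated_functor_def by blast
  interpret endofunctor C F
    using add by (simp add: additive_functor_def)
  show ?thesis
  proof (rule thickI)
    show "B \<in> {A \<in> Ob C. fob F A \<in> I}"
      if "A \<in> {A \<in> Ob C. fob F A \<in> I}" "isomorphic C A B" "B \<in> Ob C" for A B
      using that iso_closed_mem_iff[OF thick_iso_closed[OF I] far_isomorphic[OF that(2)]] by blast
    show "Z \<in> {A \<in> Ob C. fob F A \<in> I}" if "zero_object C Z" for Z
      using thick_zero_mem[OF I additive_functor_zero_object[OF add that]] that
      by (simp add: zero_object_def)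
    show "X \<in> {A \<in> Ob C. fob F A \<in> I} \<longleftrightarrow> \<Sigma>\<^sub>o X \<in> {A \<in> Ob C. fob F A \<in> I}"
      if X: "X \<in> Ob C" for X
    proof -
      have "isomorphic C (fob F (\<Sigma>\<^sub>o X)) (\<Sigma>\<^sub>o (fob F X))"
        using nat_iso_isomorphic[OF \<phi> X] by (simp add: comp_fun_def)
      then show ?thesis
        using iso_closed_mem_iff[OF thick_iso_closed[OF I]] thickD(1)[OF I fob_Ob[OF X]] X
          endofunctor.fob_Ob[OF endofunctor_shift X] by blast
    qed
    show "A \<in> {A \<in> Ob C. fob F A \<in> I} \<and> B \<in> {A \<in> Ob C. fob F A \<in> I}"
      if D: "direct_sum C A B D" "D \<in> {A \<in> Ob C. fob F A \<in> I}" for A B D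
      using direct_sum_mem_iff[OF I additive_functor_direct_sum[OF add D(1)]] D
      by (auto simp: direct_sum_def)
    fix X Y Z f g h
    assume T: "dist_triangle C X Y Z f g h"
    then have "X \<in> Ob C" "Y \<in> Ob C" "Z \<in> Ob C"
      by (auto simp: dist_triangle_def triangle_def)
    then show "(X \<in> {A \<in> Ob C. fob F A \<in> I} \<and> Y \<in> {A \<in> Ob C. fob F A \<in> I} \<longrightarrow>
        Z \<in> {A \<in> Ob C. fob F A \<in> I}) \<and>
      (Y \<in> {A \<in> Ob C. fob F A \<in> I} \<and> Z \<in> {A \<in> Ob C. fob F A \<in> I} \<longrightarrow>
        X \<in> {A \<in> Ob C. fob F A \<in> I}) \<and>
      (X \<in> {A \<in> Ob C. fob F A \<in> I} \<and> Z \<in> {A \<in> Ob C. fob F A \<in> I} \<longrightarrow>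
        Y \<in> {A \<in> Ob C. fob F A \<in> I})"
      using thickD(2-4)[OF I dist[OF T]] by blast
  qed blast
qed

end

section \<open>Thick ideals\<close>

context monoidal_triangulated_category
begin

lemma thick_ideal_thick: "thick_ideal K I \<Longrightarrow> thick_subcategory K I"
  by (simp add: thick_ideal_def)

lemma thick_ideal_Ob: "thick_ideal K I \<Longrightarrow> I \<subseteq> Ob K"
  using thick_ideal_thick thick_Ob by blast

lemma thick_ideal_iso_closed: "thick_ideal K I \<Longrightarrow> iso_closed K I"
  using thick_ideal_thick thick_iso_closed by blast

lemma thick_ideal_tob:
  "thick_ideal K I \<Longrightarrow> A \<in> I \<Longrightarrow> B \<in> Ob K \<Longrightarrow> A \<boxtimes> B \<in> I"
  "thick_ideal K I \<Longrightarrow> A \<in> I \<Longrightarrow> B \<in> Ob K \<Longrightarrow> B \<boxtimes> A \<in> I"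
  by (simp_all add: thick_ideal_def)

lemma thick_ideal_assoc_iff:
  assumes "thick_ideal K I" and "A \<in> Ob K" "B \<in> Ob K" "D \<in> Ob K"
  shows "(A \<boxtimes> B) \<boxtimes> D \<in> I \<longleftrightarrow> A \<boxtimes> (B \<boxtimes> D) \<in> I"
  using iso_closed_mem_iff[OF thick_ideal_iso_closed[OF assms(1)]] asc_iso[OF assms(2-4)]
  unfolding isomorphic_def by blast

lemma thick_tensor_preimage:
  assumes "thick_subcategory K I" and "A \<in> Ob K"
  shows "thick_subcategory K {B \<in> Ob K. A \<boxtimes> B \<in> I}"
    and "thick_subcategory K {B \<in> Ob K. B \<boxtimes> A \<in> I}"
  using thick_preimage[OF tensor_left_exact[OF assms(2)] assms(1)]
    thick_preimage[OF tensor_right_exact[OF assms(2)] assms(1)]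
  by (simp_all add: tensor_left_def tensor_right_def)

lemma thick_ideal_INT:
  assumes "\<And>r. r \<in> R \<Longrightarrow> thick_ideal K (I r)"
  shows "thick_ideal K {A \<in> Ob K. \<forall>r \<in> R. A \<in> I r}"
  using thick_INT[of R I] assms tob_Ob unfolding thick_ideal_def by blast

text \<open>Annihilators modulo \<open>P\<close> enlarge an ideal \<open>I\<close> with \<open>I \<otimes> L \<subseteq> P\<close> to one that also contains \<open>P\<close> and
  still satisfies this inclusion. They take the place of the ideal generated by \<open>I \<union> P\<close>, for which
  the inclusion would have to be traced through the generation process.\<close>

lemma thick_ideal_left_annihilator:
  assumes P: "thick_ideal K P" and L: "L \<subseteq> Ob K"
    and left: "\<And>B Y. B \<in> Ob K \<Longrightarrow> Y \<in> L \<Longrightarrow> B \<boxtimes> Y \<in> L"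
  shows "thick_ideal K {X \<in> Ob K. \<forall>Y \<in> L. X \<boxtimes> Y \<in> P}" (is "thick_ideal K ?J")
proof -
  have "?J = {X \<in> Ob K. \<forall>Y \<in> L. X \<in> {X \<in> Ob K. X \<boxtimes> Y \<in> P}}"
    by blast
  moreover have "thick_subcategory K \<dots>"
    by (rule thick_INT) (use thick_tensor_preimage(2)[OF thick_ideal_thick[OF P]] L in blast)
  ultimately have "thick_subcategory K ?J"
    by simp
  moreover have "X \<boxtimes> B \<in> ?J \<and> B \<boxtimes> X \<in> ?J" if X: "X \<in> ?J" and B: "B \<in> Ob K" for X B
  proof -
    have XO: "X \<in> Ob K"
      using X by blast
    have "(X \<boxtimes> B) \<boxtimes> Y \<in> P \<and> (B \<boxtimes> X) \<boxtimes> Y \<in> P" if Y: "Y \<in> L" for Y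
    proof -
      have YO: "Y \<in> Ob K"
        using Y L by blast
      have "X \<boxtimes> (B \<boxtimes> Y) \<in> P" and XY: "X \<boxtimes> Y \<in> P"
        using X left[OF B Y] Y by auto
      then show ?thesis
        using thick_ideal_assoc_iff[OF P XO B YO] thick_ideal_assoc_iff[OF P B XO YO]
          thick_ideal_tob(2)[OF P XY B] by simp
    qed
    then show ?thesis
      using tob_Ob[OF XO B] tob_Ob[OF B XO] by simp
  qed
  ultimately show ?thesis
    unfolding thick_ideal_def by blast
qed

lemma thick_ideal_right_annihilator:
  assumes P: "thick_ideal K P" and L: "L \<subseteq> Ob K"
    and right: "\<And>B X. B \<in> Ob K \<Longrightarrow> X \<in> L \<Longrightarrow> X \<boxtimes> B \<in> L"
  shows "thick_ideal K {Y \<in> Ob K. \<forall>X \<in> L. X \<boxtimes> Y \<in> P}" (is "thick_ideal K ?J")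
proof -
  have "?J = {Y \<in> Ob K. \<forall>X \<in> L. Y \<in> {Y \<in> Ob K. X \<boxtimes> Y \<in> P}}"
    by blast
  moreover have "thick_subcategory K \<dots>"
    by (rule thick_INT) (use thick_tensor_preimage(1)[OF thick_ideal_thick[OF P]] L in blast)
  ultimately have "thick_subcategory K ?J"
    by simp
  moreover have "Y \<boxtimes> B \<in> ?J \<and> B \<boxtimes> Y \<in> ?J" if Y: "Y \<in> ?J" and B: "B \<in> Ob K" for Y B
  proof -
    have YO: "Y \<in> Ob K"
      using Y by blast
    have "X \<boxtimes> (Y \<boxtimes> B) \<in> P \<and> X \<boxtimes> (B \<boxtimes> Y) \<in> P" if X: "X \<in> L" for X
    proof -
      have XO: "X \<in> Ob K"
        using X L by blast
      have "(X \<boxtimes> B) \<boxtimes> Y \<in> P" and XY: "X \<boxtimes> Y \<in> P"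
        using Y right[OF B X] X by auto
      then show ?thesis
        using thick_ideal_assoc_iff[OF P XO B YO] thick_ideal_assoc_iff[OF P XO YO B]
          thick_ideal_tob(1)[OF P XY B] by simp
    qed
    then show ?thesis
      using tob_Ob[OF YO B] tob_Ob[OF B YO] by simp
  qed
  ultimately show ?thesis
    unfolding thick_ideal_def by blast
qed

section \<open>Rigidity and semiprimeness\<close>

text \<open>The two triangle identities of a duality factor the identities of \<open>A\<close> and of its left dual \<open>B\<close>
  through these triple products. The second case serves right rigidity: there the given
  object is the left dual of its right dual.\<close>

lemma left_dual_retracts:
  assumes "left_dual K A B" and I: "thick_ideal K I"
  shows "(A \<boxtimes> B) \<boxtimes> A \<in> I \<Longrightarrow> A \<in> I" and "(B \<boxtimes> A) \<boxtimes> B \<in> I \<Longrightarrow> B \<in> I"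
proof -
  have A: "A \<in> Ob K" and B: "B \<in> Ob K"
    using assms(1) by (auto simp: left_dual_def)
  obtain ev co where ev: "ev \<in> Hom K (B \<boxtimes> A) \<I>" and co: "co \<in> Hom K \<I> (A \<boxtimes> B)"
    and zA: "\<r> A \<cdot> (\<one>\<^sub>m A \<boxtimes>\<^sub>m ev) \<cdot> \<a> A B A \<cdot> (co \<boxtimes>\<^sub>m \<one>\<^sub>m A) \<cdot> inv_ar K (\<l> A) = \<one>\<^sub>m A"
    and zB: "\<l> B \<cdot> (ev \<boxtimes>\<^sub>m \<one>\<^sub>m B) \<cdot> inv_ar K (\<a> B A B) \<cdot> (\<one>\<^sub>m B \<boxtimes>\<^sub>m co) \<cdot> inv_ar K (\<r> B) = \<one>\<^sub>m B"
    using assms(1) unfolding left_dual_def by blast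
  have lA: "inv_ar K (\<l> A) \<in> Hom K A (\<I> \<boxtimes> A)" and rB: "inv_ar K (\<r> B) \<in> Hom K B (B \<boxtimes> \<I>)"
    and aB: "inv_ar K (\<a> B A B) \<in> Hom K (B \<boxtimes> (A \<boxtimes> B)) (B \<boxtimes> A \<boxtimes> B)"
    using inv_ar_Hom lun_iso[OF A] run_iso[OF B] asc_iso[OF B A B] by blast+
  have coA: "co \<boxtimes>\<^sub>m \<one>\<^sub>m A \<in> Hom K (\<I> \<boxtimes> A) (A \<boxtimes> B \<boxtimes> A)"
    and Bco: "\<one>\<^sub>m B \<boxtimes>\<^sub>m co \<in> Hom K (B \<boxtimes> \<I>) (B \<boxtimes> (A \<boxtimes> B))"
    using tar_Hom co idn_Hom A B by blast+
  have pA: "\<r> A \<cdot> (\<one>\<^sub>m A \<boxtimes>\<^sub>m ev) \<cdot> \<a> A B A \<in> Hom K (A \<boxtimes> B \<boxtimes> A) A"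
    using cmp_Hom[OF asc_iso[OF A B A, THEN conjunct1]
        cmp_Hom[OF tar_Hom[OF idn_Hom[OF A] ev] run_iso[OF A, THEN conjunct1]]] .
  have pB: "\<l> B \<cdot> (ev \<boxtimes>\<^sub>m \<one>\<^sub>m B) \<in> Hom K (B \<boxtimes> A \<boxtimes> B) B"
    using cmp_Hom[OF tar_Hom[OF ev idn_Hom[OF B]] lun_iso[OF B, THEN conjunct1]] .
  show "A \<in> I" if "(A \<boxtimes> B) \<boxtimes> A \<in> I"
    using thick_retract_mem[OF thick_ideal_thick[OF I] that cmp_Hom[OF lA coA] pA]
      cmp_assoc[OF lA coA pA] zA by simp
  have iB: "inv_ar K (\<a> B A B) \<cdot> ((\<one>\<^sub>m B \<boxtimes>\<^sub>m co) \<cdot> inv_ar K (\<r> B)) \<in> Hom K B (B \<boxtimes> A \<boxtimes> B)"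
    by (rule cmp_Hom[OF cmp_Hom[OF rB Bco] aB])
  show "B \<in> I" if "(B \<boxtimes> A) \<boxtimes> B \<in> I"
    using thick_retract_mem[OF thick_ideal_thick[OF I] that iB pB]
      cmp_assoc[OF cmp_Hom[OF rB Bco] aB pB] cmp_assoc[OF rB Bco cmp_Hom[OF aB pB]] zB by simp
qed

lemma rigid_semiprime:
  assumes "left_rigid K \<or> right_rigid K" and I: "thick_ideal K I" and A: "A \<in> Ob K"
    and AA: "\<And>B. B \<in> Ob K \<Longrightarrow> (A \<boxtimes> B) \<boxtimes> A \<in> I"
  shows "A \<in> I"
proof -
  obtain B where "left_dual K A B \<or> left_dual K B A"
    using assms(1) A unfolding left_rigid_def right_rigid_def right_dual_def by blast
  then show ?thesis
    using left_dual_retracts[OF _ I] AA unfolding left_dual_def by blast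
qed

text \<open>If \<open>I \<otimes> J \<subseteq> P\<close> with neither factor in \<open>P\<close>, maximality puts \<open>A\<close> first into the left annihilator
  of \<open>J\<close> and then into the right annihilator of that ideal. So all \<open>(A \<otimes> B) \<otimes> A\<close> lie in \<open>P\<close>, against
  semiprimeness.\<close>

lemma maximal_avoiding_prime:
  assumes rigid: "left_rigid K \<or> right_rigid K" and P: "thick_ideal K P"
    and A: "A \<in> Ob K" "A \<notin> P"
    and max: "\<And>J. thick_ideal K J \<Longrightarrow> P \<subseteq> J \<Longrightarrow> A \<notin> J \<Longrightarrow> J = P"
  shows "prime_ideal K P"
  unfolding prime_ideal_def
proof (intro conjI allI impI)
  show "P \<noteq> Ob K"
    using A by blast
  fix I J
  assume IJ: "thick_ideal K I \<and> thick_ideal K J \<and> tensor_set K I J \<subseteq> P"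
  define I' where "I' = {X \<in> Ob K. \<forall>Y \<in> J. X \<boxtimes> Y \<in> P}"
  define J' where "J' = {Y \<in> Ob K. \<forall>X \<in> I'. X \<boxtimes> Y \<in> P}"
  have I': "thick_ideal K I'"
    unfolding I'_def using IJ thick_ideal_Ob thick_ideal_tob
    by (intro thick_ideal_left_annihilator[OF P]) blast+
  have J': "thick_ideal K J'"
    unfolding J'_def using I' thick_ideal_Ob thick_ideal_tob
    by (intro thick_ideal_right_annihilator[OF P]) blast+
  have "P \<subseteq> I'" "I \<subseteq> I'"
    using IJ thick_ideal_Ob thick_ideal_tob(1)[OF P] P unfolding I'_def tensor_set_def by blast+
  have "P \<subseteq> J'" "J \<subseteq> J'"
    using IJ thick_ideal_Ob[OF I'] thick_ideal_Ob[OF P] thick_ideal_Ob[of J] thick_ideal_tob(2)[OF P]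
    unfolding J'_def I'_def by blast+
  show "I \<subseteq> P \<or> J \<subseteq> P"
  proof (rule ccontr)
    assume "\<not> (I \<subseteq> P \<or> J \<subseteq> P)"
    then have "A \<in> I'" "A \<in> J'"
      using max[OF I' \<open>P \<subseteq> I'\<close>] max[OF J' \<open>P \<subseteq> J'\<close>] \<open>I \<subseteq> I'\<close> \<open>J \<subseteq> J'\<close> by blast+
    then have "(A \<boxtimes> B) \<boxtimes> A \<in> P" if "B \<in> Ob K" for B
      using thick_ideal_tob(1)[OF I' _ that] unfolding J'_def by blast
    then show False
      using rigid_semiprime[OF rigid P A(1)] A(2) by blast
  qed
qed (rule P)

lemma separating_prime_exists:
  assumes rigid: "left_rigid K \<or> right_rigid K" and I: "thick_ideal K I"
    and A: "A \<in> Ob K" "A \<notin> I"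
  shows "\<exists>P. prime_ideal K P \<and> I \<subseteq> P \<and> A \<notin> P"
proof -
  let ?S = "{J. thick_ideal K J \<and> I \<subseteq> J \<and> A \<notin> J}"
  have "\<exists>P \<in> ?S. \<forall>J \<in> ?S. P \<subseteq> J \<longrightarrow> J = P"
  proof (rule subset_Zorn_nonempty)
    show "?S \<noteq> {}"
      using I A by blast
    fix \<C> assume ne: "\<C> \<noteq> {}" and C: "subset.chain ?S \<C>"
    have ch: "J \<subseteq> L \<or> L \<subseteq> J" if "J \<in> \<C>" "L \<in> \<C>" for J L
      using C that by (auto simp: subset.chain_def)
    have sub: "\<C> \<subseteq> ?S"
      using C by (auto simp: subset.chain_def)
    have "thick_subcategory K (\<Union>\<C>)"
      using thick_Union_chain[OF _ ne ch] sub thick_ideal_thick by blast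
    then have "thick_ideal K (\<Union>\<C>)"
      using sub unfolding thick_ideal_def by blast
    then show "\<Union>\<C> \<in> ?S"
      using sub ne by blast
  qed
  then obtain P where P: "thick_ideal K P" "I \<subseteq> P" "A \<notin> P"
    and max: "\<forall>J \<in> ?S. P \<subseteq> J \<longrightarrow> J = P"
    by blast
  have "J = P" if "thick_ideal K J" "P \<subseteq> J" "A \<notin> J" for J
    using max P(2) that by blast
  then have "prime_ideal K P"
    by (rule maximal_avoiding_prime[OF rigid P(1) A(1) P(3)])
  then show ?thesis
    using P by blast
qed

lemma prime_ideal_avoid_tensor:
  assumes "prime_ideal K P" and "A \<in> Ob K" "B \<in> Ob K" and "A \<boxtimes> B \<notin> P"
  shows "A \<notin> P" and "B \<notin> P"
  using assms thick_ideal_tob unfolding prime_ideal_def by blast+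

end

section \<open>Ideals under the group action\<close>

context group_action
begin

lemma T_exact: "g \<in> carrier G \<Longrightarrow> exact_functor K (T g)"
  using monoidal_triangulated_functor.triangulated[OF T_functor] unfolding exact_functor_def by blast

lemma T_endofunctor: "g \<in> carrier G \<Longrightarrow> endofunctor K (T g)"
  using T_autoequivalence by (simp add: autoequivalence_def)

lemma T_Ob: "g \<in> carrier G \<Longrightarrow> A \<in> Ob K \<Longrightarrow> fob (T g) A \<in> Ob K"
  using endofunctor.fob_Ob[OF T_endofunctor] .

lemma T_mult_mem_iff:
  assumes "iso_closed K S" and g: "g \<in> carrier G" and h: "h \<in> carrier G" and A: "A \<in> Ob K"
  shows "fob (T g) (fob (T h) A) \<in> S \<longleftrightarrow> fob (T (g \<otimes>\<^bsub>G\<^esub> h)) A \<in> S"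
proof -
  have "nat_iso K (mt_comp K (T g) (T h)) (T (g \<otimes>\<^bsub>G\<^esub> h)) (\<gamma> g h)"
    using \<gamma>_iso[OF g h] by (simp add: mt_nat_iso_def)
  from iso_closed_mem_iff[OF assms(1) nat_iso_isomorphic[OF this A]] show ?thesis
    by (simp add: mt_comp_def)
qed

text \<open>Apply a quasi-inverse of \<open>T\<^sub>1\<close> to \<open>T\<^sub>1 (T\<^sub>1 A) \<cong> T\<^sub>1 A\<close> to obtain \<open>T\<^sub>1 A \<cong> A\<close>.\<close>

lemma T_one_mem_iff:
  assumes S: "iso_closed K S" and A: "A \<in> Ob K"
  shows "fob (T \<one>\<^bsub>G\<^esub>) A \<in> S \<longleftrightarrow> A \<in> S"
proof -
  have one: "\<one>\<^bsub>G\<^esub> \<in> carrier G"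
    by simp
  obtain H :: "('o, 'm) endofun" and \<eta> where H: "endofunctor K H"
    and \<eta>: "nat_iso K (comp_fun H (T \<one>\<^bsub>G\<^esub>)) id_fun \<eta>"
    using T_autoequivalence[OF one] unfolding autoequivalence_def by blast
  let ?T = "fob (T \<one>\<^bsub>G\<^esub>)"
  have HT: "fob H (?T B) \<in> S \<longleftrightarrow> B \<in> S" if "B \<in> Ob K" for B
    using iso_closed_mem_iff[OF S nat_iso_isomorphic[OF \<eta> that]] by (simp add: comp_fun_def id_fun_def)
  have "nat_iso K (mt_comp K (T \<one>\<^bsub>G\<^esub>) (T \<one>\<^bsub>G\<^esub>)) (T \<one>\<^bsub>G\<^esub>) (\<gamma> \<one>\<^bsub>G\<^esub> \<one>\<^bsub>G\<^esub>)"
    using \<gamma>_iso[OF one one] by (simp add: mt_nat_iso_def)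
  from nat_iso_isomorphic[OF this A] have "isomorphic K (?T (?T A)) (?T A)"
    by (simp add: mt_comp_def)
  from iso_closed_mem_iff[OF S endofunctor.far_isomorphic[OF H this]] show ?thesis
    using HT T_Ob[OF one] A by blast
qed

lemma T_inv_mem_iff:
  assumes "iso_closed K S" and "g \<in> carrier G" and "A \<in> Ob K"
  shows "fob (T g) (fob (T (inv\<^bsub>G\<^esub> g)) A) \<in> S \<longleftrightarrow> A \<in> S"
  using T_mult_mem_iff[OF assms(1,2) inv_closed[OF assms(2)] assms(3)]
    T_one_mem_iff[OF assms(1,3)] r_inv[OF assms(2)] by simp

lemma T_tensor_mem_iff:
  assumes "iso_closed K S" and g: "g \<in> carrier G" and A: "A \<in> Ob K" and B: "B \<in> Ob K"
  shows "fob (T g) A \<boxtimes>\<^bsub>K\<^esub> fob (T g) B \<in> S \<longleftrightarrow> fob (T g) (A \<boxtimes>\<^bsub>K\<^esub> B) \<in> S"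
  using iso_closed_mem_iff[OF assms(1)]
    monoidal_triangulated_functor.fmu_iso[OF T_functor[OF g] A B]
  unfolding isomorphic_def by blast

lemma G_ideal_thick_ideal: "G_ideal G K T I \<Longrightarrow> thick_ideal K I"
  by (simp add: G_ideal_def)

lemma G_ideal_T: "G_ideal G K T I \<Longrightarrow> g \<in> carrier G \<Longrightarrow> A \<in> I \<Longrightarrow> fob (T g) A \<in> I"
  by (auto simp: G_ideal_def)

lemma G_prime_ideal: "G_prime G K T Q \<Longrightarrow> G_ideal G K T Q"
  by (simp add: G_prime_def)

lemma G_ideal_INT:
  assumes "\<And>r. r \<in> R \<Longrightarrow> G_ideal G K T (I r)"
  shows "G_ideal G K T {A \<in> Ob K. \<forall>r \<in> R. A \<in> I r}"
  using thick_ideal_INT[of R I] assms T_Ob unfolding G_ideal_def by blast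

definition G_core :: "'o set \<Rightarrow> 'o set" where
  "G_core P = {A \<in> Ob K. \<forall>g \<in> carrier G. fob (T g) A \<in> P}"

lemma G_core_subset: "thick_ideal K P \<Longrightarrow> G_core P \<subseteq> P"
  using T_one_mem_iff[OF thick_ideal_iso_closed] unfolding G_core_def by blast

lemma G_core_greatest: "G_ideal G K T I \<Longrightarrow> I \<subseteq> P \<Longrightarrow> I \<subseteq> G_core P"
  using thick_ideal_Ob[OF G_ideal_thick_ideal] G_ideal_T unfolding G_core_def by blast

lemma G_core_G_ideal:
  assumes P: "thick_ideal K P"
  shows "G_ideal G K T (G_core P)"
proof -
  have eq: "G_core P = {A \<in> Ob K. \<forall>g \<in> carrier G. A \<in> {A \<in> Ob K. fob (T g) A \<in> P}}"
    unfolding G_core_def by blast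
  have "thick_ideal K {A \<in> Ob K. fob (T g) A \<in> P}" (is "thick_ideal K ?J")
    if g: "g \<in> carrier G" for g
  proof -
    have "A \<boxtimes>\<^bsub>K\<^esub> B \<in> ?J \<and> B \<boxtimes>\<^bsub>K\<^esub> A \<in> ?J" if A: "A \<in> ?J" and B: "B \<in> Ob K" for A B
    proof -
      have AO: "A \<in> Ob K" and TA: "fob (T g) A \<in> P"
        using A by auto
      then show ?thesis
        using T_tensor_mem_iff[OF thick_ideal_iso_closed[OF P] g AO B]
          T_tensor_mem_iff[OF thick_ideal_iso_closed[OF P] g B AO]
          thick_ideal_tob[OF P TA T_Ob[OF g B]] tob_Ob[OF AO B] tob_Ob[OF B AO] by simp
    qed
    then show ?thesis
      using thick_preimage[OF T_exact[OF g] thick_ideal_thick[OF P]]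
      unfolding thick_ideal_def by blast
  qed
  then have "thick_ideal K (G_core P)"
    unfolding eq by (rule thick_ideal_INT)
  moreover have "fob (T g) A \<in> G_core P" if "g \<in> carrier G" "A \<in> G_core P" for g A
    using that T_mult_mem_iff[OF thick_ideal_iso_closed[OF P]] T_Ob unfolding G_core_def by auto
  ultimately show ?thesis
    unfolding G_ideal_def by blast
qed

lemma G_core_prime:
  assumes "prime_ideal K P"
  shows "G_prime G K T (G_core P)"
proof -
  have P: "thick_ideal K P" "P \<noteq> Ob K"
    using assms by (auto simp: prime_ideal_def)
  have "I \<subseteq> G_core P \<or> J \<subseteq> G_core P"
    if "G_ideal G K T I" "G_ideal G K T J" "tensor_set K I J \<subseteq> G_core P" for I J
    using assms that G_core_subset[OF P(1)] G_core_greatest G_ideal_thick_ideal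
    unfolding prime_ideal_def by (meson subset_trans)
  moreover have "G_core P \<noteq> Ob K"
    using G_core_subset[OF P(1)] thick_ideal_Ob[OF P(1)] P(2) by blast
  ultimately show ?thesis
    unfolding G_prime_def using G_core_G_ideal[OF P(1)] by blast
qed

lemma separating_G_prime_exists:
  assumes "left_rigid K \<or> right_rigid K" and I: "G_ideal G K T I"
    and A: "A \<in> Ob K" "A \<notin> I"
  shows "\<exists>Q. G_prime G K T Q \<and> I \<subseteq> Q \<and> A \<notin> Q"
proof -
  obtain P where P: "prime_ideal K P" "I \<subseteq> P" "A \<notin> P"
    using separating_prime_exists[OF assms(1) G_ideal_thick_ideal[OF I] A] by blast
  then show ?thesis
    using G_core_prime[OF P(1)] G_core_greatest[OF I P(2)] G_core_subset[of P]
    unfolding prime_ideal_def by blast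
qed

text \<open>Stability under the action: \<open>T\<^sub>g X \<otimes> Y\<close> is, up to isomorphism, \<open>T\<^sub>g (X \<otimes> T\<^sub>h Y)\<close> with \<open>h\<close> the
  inverse of \<open>g\<close>, and \<open>T\<^sub>h Y\<close> is again in \<open>L\<close>.\<close>

lemma G_ideal_left_annihilator:
  assumes Q: "G_ideal G K T Q" and L: "G_ideal G K T L"
  shows "G_ideal G K T {X \<in> Ob K. \<forall>Y \<in> L. X \<boxtimes>\<^bsub>K\<^esub> Y \<in> Q}" (is "G_ideal G K T ?J")
proof -
  note Qt = G_ideal_thick_ideal[OF Q] and Lt = G_ideal_thick_ideal[OF L]
  have "thick_ideal K ?J"
    by (rule thick_ideal_left_annihilator[OF Qt thick_ideal_Ob[OF Lt] thick_ideal_tob(2)[OF Lt]])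
  moreover have "fob (T g) X \<in> ?J" if g: "g \<in> carrier G" and X: "X \<in> ?J" for g X
  proof -
    have "fob (T g) X \<boxtimes>\<^bsub>K\<^esub> Y \<in> Q" if Y: "Y \<in> L" for Y
    proof -
      let ?Y = "fob (T (inv\<^bsub>G\<^esub> g)) Y"
      have TX: "fob (T g) X \<in> Ob K" and YO: "Y \<in> Ob K"
        using T_Ob[OF g] X Y thick_ideal_Ob[OF Lt] by blast+
      have "?Y \<in> L"
        using G_ideal_T[OF L inv_closed[OF g] Y] .
      then have Y': "?Y \<in> Ob K" "X \<boxtimes>\<^bsub>K\<^esub> ?Y \<in> Q"
        using thick_ideal_Ob[OF Lt] X by blast+
      then have "fob (T g) X \<boxtimes>\<^bsub>K\<^esub> fob (T g) ?Y \<in> Q"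
        using T_tensor_mem_iff[OF thick_ideal_iso_closed[OF Qt] g _ Y'(1)]
          G_ideal_T[OF Q g Y'(2)] X by simp
      moreover have "iso_closed K {B \<in> Ob K. fob (T g) X \<boxtimes>\<^bsub>K\<^esub> B \<in> Q}"
        using thick_iso_closed[OF thick_tensor_preimage(1)[OF thick_ideal_thick[OF Qt] TX]] .
      ultimately show ?thesis
        using T_inv_mem_iff[OF _ g YO, of "{B \<in> Ob K. fob (T g) X \<boxtimes>\<^bsub>K\<^esub> B \<in> Q}"]
          T_Ob[OF g Y'(1)] by simp
    qed
    then show ?thesis
      using T_Ob[OF g] X by blast
  qed
  ultimately show ?thesis
    unfolding G_ideal_def by blast
qed

text \<open>The elementwise form of \<open>G\<close>-primeness. The object \<open>E\<close> is \<open>A \<otimes> Y\<close> with \<open>Y\<close> in the \<open>G\<close>-ideal generated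
  by \<open>B\<close>. Generating a \<open>G\<close>-ideal on one side only is what makes \<open>E \<notin> P\<close> force \<open>A \<notin> P\<close>, and not just
  that \<open>P\<close> misses some translate of \<open>A\<close>.\<close>

lemma G_prime_avoid_tensor:
  assumes Q: "G_prime G K T Q" and A: "A \<in> Ob K" "A \<notin> Q" and B: "B \<in> Ob K" "B \<notin> Q"
  shows "\<exists>E \<in> Ob K - Q. \<forall>P. prime_ideal K P \<and> E \<notin> P \<longrightarrow> A \<notin> P \<and> B \<notin> G_core P"
proof -
  note QG = G_prime_ideal[OF Q]
  define L where "L = {Y \<in> Ob K. \<forall>I \<in> {I. G_ideal G K T I \<and> B \<in> I}. Y \<in> I}"
  have L: "G_ideal G K T L"
    unfolding L_def by (rule G_ideal_INT) blast
  have BL: "B \<in> L"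
    using B(1) by (simp add: L_def)
  let ?J = "{X \<in> Ob K. \<forall>Y \<in> L. X \<boxtimes>\<^bsub>K\<^esub> Y \<in> Q}"
  have "tensor_set K ?J L \<subseteq> Q"
    unfolding tensor_set_def by blast
  then have "?J \<subseteq> Q"
    using Q G_ideal_left_annihilator[OF QG L] L BL B(2) unfolding G_prime_def by blast
  then obtain Y where Y: "Y \<in> L" "A \<boxtimes>\<^bsub>K\<^esub> Y \<notin> Q"
    using A by blast
  have YO: "Y \<in> Ob K"
    using Y(1) by (simp add: L_def)
  have "A \<notin> P \<and> B \<notin> G_core P" if P: "prime_ideal K P" "A \<boxtimes>\<^bsub>K\<^esub> Y \<notin> P" for P
  proof -
    have Pt: "thick_ideal K P"
      using P(1) by (simp add: prime_ideal_def)
    have "A \<notin> P" "Y \<notin> P"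
      using prime_ideal_avoid_tensor[OF P(1) A(1) YO P(2)] .
    moreover have "Y \<in> G_core P" if "B \<in> G_core P"
      using Y(1) that G_core_G_ideal[OF Pt] unfolding L_def by blast
    ultimately show ?thesis
      using G_core_subset[OF Pt] by blast
  qed
  then show ?thesis
    using Y(2) tob_Ob[OF A(1) YO] by blast
qed

end

section \<open>Noetherian spectra\<close>

lemma noetherian_space_minimal_closed:
  assumes X: "noetherian_space X" and F: "Z\<^sub>0 \<in> \<F>" "\<And>Z. Z \<in> \<F> \<Longrightarrow> closedin X Z"
  shows "\<exists>Z \<in> \<F>. \<forall>Z' \<in> \<F>. Z' \<subseteq> Z \<longrightarrow> Z' = Z"
proof -
  let ?R = "{(Z', Z). closedin X Z' \<and> closedin X Z \<and> Z' \<subset> Z}"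
  have "\<nexists>C. \<forall>n. (C (Suc n), C n) \<in> ?R"
  proof
    assume "\<exists>C. \<forall>n. (C (Suc n), C n) \<in> ?R"
    then obtain C where R: "\<forall>n. (C (Suc n), C n) \<in> ?R"
      by (elim exE)
    have C: "closedin X (C n)" "C (Suc n) \<subset> C n" for n
      using R[rule_format, of n] by simp_all
    then have "decseq C"
      by (intro decseq_SucI) blast
    then obtain N where "\<forall>n \<ge> N. C n = C N"
      using X C(1) unfolding noetherian_space_def by blast
    then have "C (Suc N) = C N"
      using le_SucI[OF order_refl] by blast
    then show False
      using C(2)[of N] by blast
  qed
  then have wf: "wf ?R"
    by (simp add: wf_iff_no_infinite_down_chain)
  have "\<exists>Z \<in> \<F>. \<forall>Z'. (Z', Z) \<in> ?R \<longrightarrow> Z' \<notin> \<F>"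
    using wf[unfolded wf_eq_minimal, rule_format, OF F(1)] .
  then obtain Z where Z: "Z \<in> \<F>" and min: "\<forall>Z'. (Z', Z) \<in> ?R \<longrightarrow> Z' \<notin> \<F>"
    by (elim bexE)
  have "Z' = Z" if "Z' \<in> \<F>" "Z' \<subseteq> Z" for Z'
    using min[rule_format, of Z'] F(2)[OF Z] F(2)[OF that(1)] that by auto
  then show ?thesis
    using Z by blast
qed

text \<open>Every prime avoiding an \<open>E\<close> with \<open>V E\<close> minimal among the objects outside \<open>Q\<close> has its core in \<open>Q\<close>.
  The descending chain condition is applied in \<open>Spc K\<close>, not to the sets \<open>V\<^sup>G E\<close>: the latter correspond
  to unions of translates of \<open>V E\<close>, which need not be closed in \<open>Spc K\<close>.\<close>

lemma (in group_action) G_prime_closure_support: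
  assumes rigid: "left_rigid K \<or> right_rigid K" and noeth: "noetherian_space (Spc_topology K)"
    and Q: "G_prime G K T Q"
  shows "\<exists>E \<in> Ob K - Q. \<forall>Q'. G_prime G K T Q' \<and> E \<notin> Q' \<longrightarrow> Q' \<subseteq> Q"
proof -
  let ?F = "{V K {E} | E. E \<in> Ob K - Q}"
  obtain E\<^sub>0 where "E\<^sub>0 \<in> Ob K - Q"
    using Q thick_ideal_Ob[OF G_ideal_thick_ideal[OF G_prime_ideal[OF Q]]]
    unfolding G_prime_def by blast
  then have "V K {E\<^sub>0} \<in> ?F"
    by blast
  moreover have "closedin (Spc_topology K) Z" if "Z \<in> ?F" for Z
    using that unfolding closedin_Spc_topology by blast
  ultimately have "\<exists>Z \<in> ?F. \<forall>Z' \<in> ?F. Z' \<subseteq> Z \<longrightarrow> Z' = Z"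
    by (rule noetherian_space_minimal_closed[OF noeth])
  then obtain Z where Z: "Z \<in> ?F" "\<forall>Z' \<in> ?F. Z' \<subseteq> Z \<longrightarrow> Z' = Z"
    by (elim bexE)
  then obtain E where E: "E \<in> Ob K" "E \<notin> Q" and ZE: "Z = V K {E}"
    by auto
  have min: "V K {E'} = V K {E}" if "E' \<in> Ob K - Q" "V K {E'} \<subseteq> V K {E}" for E'
  proof -
    have "V K {E'} \<in> ?F"
      using that(1) by auto
    then show ?thesis
      using Z(2) that(2) unfolding ZE by simp
  qed
  have core: "G_core P \<subseteq> Q" if P: "prime_ideal K P" "E \<notin> P" for P
  proof
    fix B assume B: "B \<in> G_core P"
    show "B \<in> Q"
    proof (rule ccontr)
      assume "B \<notin> Q"
      moreover have "B \<in> Ob K"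
        using B by (simp add: G_core_def)
      ultimately have "\<exists>E' \<in> Ob K - Q.
          \<forall>P. prime_ideal K P \<and> E' \<notin> P \<longrightarrow> E \<notin> P \<and> B \<notin> G_core P"
        using G_prime_avoid_tensor[OF Q E] by simp
      then obtain E' where E': "E' \<in> Ob K - Q"
        and avoid: "\<forall>P. prime_ideal K P \<and> E' \<notin> P \<longrightarrow> E \<notin> P \<and> B \<notin> G_core P"
        by (elim bexE)
      have "V K {E'} \<subseteq> V K {E}"
        using avoid unfolding V_def Spc_def by auto
      then have "P \<in> V K {E'}"
        using min[OF E'] P unfolding V_def Spc_def by auto
      then show False
        using avoid B unfolding V_def Spc_def by auto
    qed
  qed
  have "Q' \<subseteq> Q" if Q': "G_prime G K T Q'" "E \<notin> Q'" for Q'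
  proof -
    obtain P where P: "prime_ideal K P" "Q' \<subseteq> P" "E \<notin> P"
      using separating_prime_exists[OF rigid G_ideal_thick_ideal[OF G_prime_ideal[OF Q'(1)]] E(1) Q'(2)]
      by blast
    then show ?thesis
      using G_core_greatest[OF G_prime_ideal[OF Q'(1)]] core by blast
  qed
  then show ?thesis
    using E by auto
qed

section \<open>The classification of ideals\<close>

theorem proposition7p4:
  fixes G :: "('g, 'x) monoid_scheme"
    and K :: "('o, 'm, 'z) mt_cat_scheme"
    and T :: "'g \<Rightarrow> ('o, 'm) mt_fun"
    and \<gamma> :: "'g \<Rightarrow> 'g \<Rightarrow> 'o \<Rightarrow> 'm"
  assumes "group G"
    and "monoidal_triangulated_category K"
    and "group_action G K T \<gamma>"
    and "left_rigid K \<or> right_rigid K"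
    and "noetherian_space (Spc_topology K)"
  shows "bij_betw (G_support G K T)
           {I. G_ideal G K T I}
           {S. specialization_closed (G_Spc_topology G K T) S}"
proof -
  interpret group_action G K T \<gamma>
    by (rule assms(3))
  have mem: "Q \<in> G_support G K T I \<longleftrightarrow> G_prime G K T Q \<and> \<not> I \<subseteq> Q" for I Q
    unfolding G_support_def V_G_def G_Spc_def by blast
  show ?thesis
    unfolding bij_betw_def
  proof
    have le: "I \<subseteq> J" if I: "G_ideal G K T I" and J: "G_ideal G K T J"
      and eq: "G_support G K T I = G_support G K T J" for I J
    proof
      fix A assume A: "A \<in> I"
      show "A \<in> J"
      proof (rule ccontr)
        assume "A \<notin> J"
        then obtain Q where Q: "G_prime G K T Q" "J \<subseteq> Q" "A \<notin> Q"
          using separating_G_prime_exists[OF assms(4) J, of A] A thick_ideal_Ob[OF G_ideal_thick_ideal[OF I]]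
          by auto
        then have "Q \<in> G_support G K T I"
          using A by (auto simp: mem)
        then show False
          using Q(2) unfolding eq mem by simp
      qed
    qed
    then show "inj_on (G_support G K T) {I. G_ideal G K T I}"
      unfolding inj_on_def by (metis mem_Collect_eq subset_antisym)
    show "G_support G K T ` {I. G_ideal G K T I} =
        {S. specialization_closed (G_Spc_topology G K T) S}"
    proof (intro equalityI subsetI)
      fix S assume "S \<in> G_support G K T ` {I. G_ideal G K T I}"
      then obtain I where I: "G_ideal G K T I" "S = G_support G K T I"
        by blast
      have "closedin (G_Spc_topology G K T) (V_G G K T {A})" if "A \<in> I" for A
        using that thick_ideal_Ob[OF G_ideal_thick_ideal[OF I(1)]]
        unfolding closedin_G_Spc_topology by (intro exI[of _ "{A}"]) auto
      then show "S \<in> {S. specialization_closed (G_Spc_topology G K T) S}"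
        unfolding specialization_closed_def I(2) G_support_def
        by (intro CollectI exI[of _ "(\<lambda>A. V_G G K T {A}) ` I"]) auto
    next
      fix W assume "W \<in> {S. specialization_closed (G_Spc_topology G K T) S}"
      then obtain \<C> where C: "\<And>Z. Z \<in> \<C> \<Longrightarrow> \<exists>S \<subseteq> Ob K. Z = V_G G K T S" "W = \<Union>\<C>"
        unfolding specialization_closed_def closedin_G_Spc_topology by blast
      \<comment> \<open>\<open>Q'\<close> lies in the closure of \<open>Q\<close>\<close>
      have down: "Q' \<in> W" if "Q \<in> W" "G_prime G K T Q'" "Q' \<subseteq> Q" for Q Q'
      proof -
        obtain Z where Z: "Z \<in> \<C>" "Q \<in> Z"
          using \<open>Q \<in> W\<close> C(2) by blast
        moreover obtain S where "Z = V_G G K T S"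
          using C(1)[OF Z(1)] by blast
        ultimately have "Q' \<in> Z"
          using that unfolding V_G_def G_Spc_def by blast
        then show ?thesis
          using Z(1) C(2) by blast
      qed
      have prime: "G_prime G K T Q" if "Q \<in> W" for Q
        using that C unfolding V_G_def G_Spc_def by blast
      define I where "I = {A \<in> Ob K. \<forall>Q \<in> {Q. G_prime G K T Q \<and> Q \<notin> W}. A \<in> Q}"
      have "G_ideal G K T I"
        unfolding I_def by (rule G_ideal_INT) (use G_prime_ideal in blast)
      moreover have "G_support G K T I = W"
      proof (intro Set.set_eqI iffI)
        fix Q
        show "Q \<in> W" if "Q \<in> G_support G K T I"
          using that unfolding mem I_def by auto
        assume Q: "Q \<in> W"
        obtain E where "E \<in> Ob K - Q" "\<forall>Q'. G_prime G K T Q' \<and> E \<notin> Q' \<longrightarrow> Q' \<subseteq> Q"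
          using G_prime_closure_support[OF assms(4,5) prime[OF Q]] by (elim bexE)
        then have "E \<in> I" "E \<notin> Q"
          using down[OF Q] unfolding I_def by auto
        then show "Q \<in> G_support G K T I"
          using prime[OF Q] by (auto simp: mem)
      qed
      ultimately show "W \<in> G_support G K T ` {I. G_ideal G K T I}"
        by blast
    qed
  qed
qed

end
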